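(* Let $\Phi$ satisfy the following hypothesis: (i) $\Phi:\mathbb{R}^+\to\mathbb{R}^+$ is an increasing concave function with $\Phi(0)=0$, and $\Phi$ is $C^2$ in a neighborhood of $+\infty$; (ii) there exists $B>1$ such that for $x$ large enough $\Phi(2x)\ge B\Phi(x)$; (iii) there exists $C>0$ such that for $x$ large enough $|x\Phi''(x)|\le C\Phi'(x)$. Let $d\mu_\Phi(x)=Z_\Phi^{-1}e^{-\Phi(|x|)}dx$ be the associated probability measure on $\mathbb{R}$. Then there exist $c_\Phi,\tilde c_\Phi,k_\Phi>0$ such that for any $n\ge1$, any $1$-Lipschitz function $F:\mathbb{R}^n\to\mathbb{R}$ and any integer $k\ge k_\Phi$ one has $$\mu_\Phi^n(|F-m|>k)\le6\exp\Big(-c_\Phi\,k\,\Phi'\circ\Phi^{-1}\big(\max(\Phi(k),2\log n)\big)\Big)\le6\max\Big(e^{-\tilde c_\Phi\Phi(k)},\,e^{-c_\Phi k\,\Phi'\circ\Phi^{-1}(2\log n)}\Big),$$ where $m$ is a median of $F$ under $\mu_\Phi^n$.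
   Context: $Z_\Phi=\int_{\mathbb{R}}e^{-\Phi(|x|)}dx$ is the normalizing constant, $n$ is an integer, and $\mu_\Phi^n$ is the $n$-fold product measure on $\mathbb{R}^n$. Lipschitz is with respect to the Euclidean distance. At points where $\Phi$ is not differentiable, $\Phi'(x)$ stands for the right derivative (when $n=1$, $\Phi^{-1}(2\log n)=0$ and $\Phi'(0)$ is the right derivative at $0$, possibly $+\infty$, in which case the corresponding exponential is $0$). $\Phi^{-1}$ is the inverse function of $\Phi$. *)

theory Defs
  imports "HOL-Analysis.Analysis"
begin

text \<open>
  The half-line \<open>{0..}\<close> is the domain and the codomain of \<open>\<Phi>\<close>, which is
  modelled by a total function \<open>real \<Rightarrow> real\<close>; its values at negative
  arguments are never used.
\<close>

definition C2_near_top :: "(real \<Rightarrow> real) \<Rightarrow> bool" where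
  "C2_near_top f \<longleftrightarrow>
     (\<exists>a. (\<forall>x>a. f differentiable (at x)) \<and> (\<forall>x>a. deriv f differentiable (at x)) \<and>
          continuous_on {a<..} (deriv (deriv f)))"

text \<open>
  The right derivative takes extended real values, because that of a concave function
  may be \<open>\<infinity>\<close> at the left endpoint of its domain.  It agrees with the
  derivative wherever the latter exists (lemma \<open>right_deriv_eq_deriv\<close> below).
\<close>

definition right_deriv :: "(real \<Rightarrow> real) \<Rightarrow> real \<Rightarrow> ereal" where
  "right_deriv f x = Lim (at_right 0) (\<lambda>h. ereal ((f (x + h) - f x) / h))"

lemma right_deriv_eqI:
  assumes "((\<lambda>h. ereal ((f (x + h) - f x) / h)) \<longlongrightarrow> D) (at_right 0)"
  shows "right_deriv f x = D"
  unfolding right_deriv_def by (rule tendsto_Lim) (use assms in simp_all)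

lemma right_deriv_eq_deriv:
  assumes "(f has_real_derivative D) (at x)"
  shows "right_deriv f x = ereal D"
proof (rule right_deriv_eqI)
  have "((\<lambda>h. (f (x + h) - f x) / h) \<longlongrightarrow> D) (at 0)"
    using assms by (simp add: DERIV_def)
  then have "((\<lambda>h. (f (x + h) - f x) / h) \<longlongrightarrow> D) (at_right 0)"
    by (rule tendsto_mono[OF at_le, rotated]) simp
  then show "((\<lambda>h. ereal ((f (x + h) - f x) / h)) \<longlongrightarrow> ereal D) (at_right 0)"
    by (rule tendsto_ereal)
qed

text \<open>
  The value \<open>exp (- t)\<close> with the convention that it is \<open>0\<close> for
  \<open>t = \<infinity>\<close>; the argument \<open>- \<infinity>\<close> does not arise for an increasing \<open>\<Phi>\<close>.
\<close>

definition exp_neg :: "ereal \<Rightarrow> real" where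
  "exp_neg t = (if t = \<infinity> then 0 else exp (- real_of_ereal t))"

definition Z_Phi :: "(real \<Rightarrow> real) \<Rightarrow> real" where
  "Z_Phi \<Phi> = (LINT x|lborel. exp (- \<Phi> \<bar>x\<bar>))"

definition mu_Phi :: "(real \<Rightarrow> real) \<Rightarrow> real measure" where
  "mu_Phi \<Phi> = density lborel (\<lambda>x. ennreal (exp (- \<Phi> \<bar>x\<bar>) / Z_Phi \<Phi>))"

text \<open>
  The dimension \<open>n\<close> is quantified after the constants, so \<open>\<real>\<close> to the power \<open>n\<close> is
  represented by the extensional functions \<open>{..<n} \<rightarrow>\<^sub>E UNIV\<close>, the underlying
  space of the product measure.
\<close>

definition mu_Phi_n :: "(real \<Rightarrow> real) \<Rightarrow> nat \<Rightarrow> (nat \<Rightarrow> real) measure" where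
  "mu_Phi_n \<Phi> n = (\<Pi>\<^sub>M i\<in>{..<n}. mu_Phi \<Phi>)"

definition one_Lipschitz :: "nat \<Rightarrow> ((nat \<Rightarrow> real) \<Rightarrow> real) \<Rightarrow> bool" where
  "one_Lipschitz n F \<longleftrightarrow>
     (\<forall>x\<in>{..<n} \<rightarrow>\<^sub>E UNIV. \<forall>y\<in>{..<n} \<rightarrow>\<^sub>E UNIV.
        \<bar>F x - F y\<bar> \<le> L2_set (\<lambda>i. x i - y i) {..<n})"

definition is_median :: "'a measure \<Rightarrow> ('a \<Rightarrow> real) \<Rightarrow> real \<Rightarrow> bool" where
  "is_median M F m \<longleftrightarrow>
     measure M {x \<in> space M. F x \<le> m} \<ge> 1/2 \<and> measure M {x \<in> space M. F x \<ge> m} \<ge> 1/2"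

lemma space_mu_Phi_n: "space (mu_Phi_n \<Phi> n) = ({..<n} \<rightarrow>\<^sub>E UNIV)"
  by (simp add: mu_Phi_n_def mu_Phi_def space_PiM)

end

theory Submission
  imports Defs "HOL-Probability.Probability"
begin

text \<open>
  Put \<open>R = \<Phi>\<^sup>-\<^sup>1(max(\<Phi>(k), 2 log n))\<close> and \<open>D = \<Phi>'(R)\<close>. By concavity, \<open>\<Phi>\<close> increases on \<open>[0, R]\<close> with
  slope at least \<open>D\<close>, so \<open>\<mu>\<close> restricted to \<open>[-R, R]\<close> satisfies a linear isoperimetric inequality
  with constant \<open>D\<close>. A transport argument of Prekopa--Leindler type in the coordinate in which
  the mass distribution is \<open>(1 + sin s)/2\<close> turns this into Maurey's property \<open>(\<tau>)\<close>: if
  \<open>u(x) v(y) \<le> exp(w(x - y))\<close> on \<open>[-R, R]\<close> with \<open>w(t) = 2 (sqrt(1 + (D t/4)\<^sup>2) - 1)\<close>, then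
  \<open>\<integral>u d\<mu> \<integral>v d\<mu> \<le> 1\<close>. This property tensorises by Fubini's theorem. Applied to
  \<open>u = exp(-D(F - m)/2)\<close> and \<open>v = exp(D(F - m)/2 - 2)\<close> on the cube \<open>[-R, R]\<^sup>n\<close>, it bounds the deviation
  probability within the cube by a multiple of \<open>exp(-D k/2)\<close>. The complement of the cube has
  probability at most a multiple of \<open>n exp(-3 \<Phi>(R)/4) \<le> exp(-\<Phi>(R)/4)\<close>, and
  \<open>\<Phi>(R) \<ge> R \<Phi>'(R) \<ge> k D\<close>.
\<close>

subsection \<open>Property \<open>(\<tau>)\<close> on an interval\<close>

text \<open>Since \<open>tanh y = sinh y / sqrt (1 + (sinh y)\<^sup>2)\<close> and
  \<open>y \<le> sinh y\<close> for \<open>0 \<le> y\<close>, the derivative of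
  \<open>ln (cosh y)\<close> dominates that of \<open>sqrt (1 + y\<^sup>2)\<close>; evenness covers
  negative \<open>y\<close>. This turns the transport cost into the hyperbolic cosine of the
  midpoint identity below.\<close>

lemma exp_sqrt_le_cosh: "exp (sqrt (1 + y\<^sup>2) - 1) \<le> cosh y" for y :: real
proof -
  have main: "exp (sqrt (1 + y\<^sup>2) - 1) \<le> cosh y" if "y \<ge> 0" for y :: real
  proof -
    have "ln (cosh 0) - sqrt (1 + 0\<^sup>2) \<le> ln (cosh y) - sqrt (1 + y\<^sup>2)"
    proof (rule DERIV_nonneg_imp_nondecreasing[OF that])
      fix x :: real
      assume x: "0 \<le> x" "x \<le> y"
      have pos: "0 < 1 + x\<^sup>2"
        by (simp add: add_pos_nonneg)
      have "((\<lambda>y. ln (cosh y) - sqrt (1 + y\<^sup>2)) has_real_derivative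
          sinh x / cosh x - x / sqrt (1 + x\<^sup>2)) (at x)"
        using pos by (auto intro!: derivative_eq_intros simp: field_simps)
      moreover have "x / sqrt (1 + x\<^sup>2) \<le> sinh x / cosh x"
      proof -
        have "(\<lambda>x. sinh x - x) 0 \<le> (\<lambda>x. sinh x - x) x"
          by (rule DERIV_nonneg_imp_nondecreasing[OF x(1)])
            (auto intro!: exI derivative_eq_intros simp: cosh_real_ge_1)
        then have "x \<le> sinh x" by simp
        then have sq: "x\<^sup>2 \<le> (sinh x)\<^sup>2"
          using x by (intro power_mono) auto
        have "x * cosh x \<le> sinh x * sqrt (1 + x\<^sup>2)"
        proof (rule power2_le_imp_le)
          show "(x * cosh x)\<^sup>2 \<le> (sinh x * sqrt (1 + x\<^sup>2))\<^sup>2"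
            using sq by (simp add: power_mult_distrib cosh_square_eq algebra_simps)
          show "0 \<le> sinh x * sqrt (1 + x\<^sup>2)"
            using x by simp
        qed
        then show ?thesis
          using pos by (simp add: field_simps)
      qed
      ultimately show "\<exists>d. ((\<lambda>y. ln (cosh y) - sqrt (1 + y\<^sup>2)) has_real_derivative d) (at x) \<and> 0 \<le> d"
        by (intro exI conjI) auto
    qed
    then have "sqrt (1 + y\<^sup>2) - 1 \<le> ln (cosh y)" by simp
    then show ?thesis
      by (metis cosh_real_pos exp_le_cancel_iff exp_ln)
  qed
  show ?thesis
    using main[of "\<bar>y\<bar>"] by simp
qed

text \<open>Behind this is the Gudermannian relation: \<open>cos (arcsin r)\<close> and
  \<open>cosh (artanh r)\<close> are reciprocal. By the half-angle formulas, twice either side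
  equals \<open>1 - p * q + sqrt (1 - p\<^sup>2) * sqrt (1 - q\<^sup>2)\<close>.\<close>

lemma cos_arcsin_midpoint:
  fixes p q :: real
  assumes p: "\<bar>p\<bar> < 1" and q: "\<bar>q\<bar> < 1"
  shows "(cos ((arcsin p + arcsin q) / 2))\<^sup>2 =
    sqrt (1 - p\<^sup>2) * sqrt (1 - q\<^sup>2) * (cosh ((artanh p - artanh q) / 2))\<^sup>2"
proof -
  have hyp: "cosh (artanh r) = 1 / sqrt (1 - r\<^sup>2) \<and> sinh (artanh r) = r / sqrt (1 - r\<^sup>2)"
    if "\<bar>r\<bar> < 1" for r :: real
  proof -
    have pos: "0 < 1 + r" "0 < 1 - r" using that by auto
    have sq: "sqrt (1 - r\<^sup>2) = sqrt (1 + r) * sqrt (1 - r)"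
      by (simp add: power2_eq_square algebra_simps flip: real_sqrt_mult)
    have e: "exp (artanh r) = sqrt (1 + r) / sqrt (1 - r)"
      using pos by (simp add: artanh_def powr_half_sqrt[symmetric] powr_def ln_div exp_diff field_simps flip: exp_add)
    have e': "exp (- artanh r) = sqrt (1 - r) / sqrt (1 + r)"
      using pos by (simp add: exp_minus e)
    have "sqrt (1 + r) * sqrt (1 + r) = 1 + r" "sqrt (1 - r) * sqrt (1 - r) = 1 - r"
      using pos by auto
    then show ?thesis
      using pos by (simp add: cosh_field_def sinh_field_def e e' sq field_simps)
  qed
  have cp: "0 < sqrt (1 - p\<^sup>2)" "0 < sqrt (1 - q\<^sup>2)"
    using p q by (auto simp: abs_square_less_1)
  have "2 * (cos ((arcsin p + arcsin q) / 2))\<^sup>2 = 1 + cos (arcsin p + arcsin q)"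
    using cos_double_cos[of "(arcsin p + arcsin q) / 2"] by (simp del: distrib_left_numeral)
  also have "\<dots> = 1 + (sqrt (1 - p\<^sup>2) * sqrt (1 - q\<^sup>2) - p * q)"
    using p q by (simp add: cos_add cos_arcsin)
  also have "\<dots> = sqrt (1 - p\<^sup>2) * sqrt (1 - q\<^sup>2) * (1 + cosh (artanh p - artanh q))"
    using cp by (simp add: cosh_diff hyp[OF p] hyp[OF q] field_simps)
  also have "1 + cosh (artanh p - artanh q) = 2 * (cosh ((artanh p - artanh q) / 2))\<^sup>2"
    using cosh_double[of "(artanh p - artanh q) / 2"]
    by (simp add: cosh_square_eq del: right_diff_distrib_numeral)
  finally show ?thesis by simp
qed

section \<open>Cumulative masses on an interval and the transport argument\<close>

lemma integral_fun_pos: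
  fixes g :: "real \<Rightarrow> real"
  assumes "a < b" and cont: "continuous_on {a..b} g" and pos: "\<And>x. x \<in> {a..b} \<Longrightarrow> 0 < g x"
    and G_def: "G = (\<lambda>x. integral {a..x} g)"
  shows "continuous_on {a..b} G" "G a = 0" "strict_mono_on {a..b} G"
    "\<And>x. x \<in> {a<..<b} \<Longrightarrow> (G has_real_derivative g x) (at x)"
proof -
  show co: "continuous_on {a..b} G"
    unfolding G_def by (intro indefinite_integral_continuous_1 integrable_continuous_real cont)
  show "G a = 0" by (simp add: G_def)
  show der: "(G has_real_derivative g x) (at x)" if "x \<in> {a<..<b}" for x
  proof -
    have "(G has_real_derivative g x) (at x within {a..b})"
      unfolding G_def using that by (intro integral_has_real_derivative cont) auto
    moreover have "at x within {a..b} = at x"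
      using that by (intro at_within_interior) (auto simp: interior_atLeastAtMost_real)
    ultimately show ?thesis by simp
  qed
  show "strict_mono_on {a..b} G"
  proof (rule strict_mono_onI)
    fix r s assume rs: "r \<in> {a..b}" "s \<in> {a..b}" "r < s"
    show "G r < G s"
    proof (rule DERIV_pos_imp_increasing_open[OF rs(3)])
      show "\<exists>y. (G has_real_derivative y) (at x) \<and> 0 < y" if "r < x" "x < s" for x
        using der[of x] pos[of x] that rs by auto
      show "continuous_on {r..s} G"
        using co rs by (elim continuous_on_subset) auto
    qed
  qed
qed

text \<open>Here \<open>p\<close> is the mass to the left, rescaled to run from -1 to 1. With
  \<open>P\<close> that mass and \<open>N\<close> the total, \<open>artanh (p x)\<close> has
  derivative \<open>\<rho> x * N / (2 * P x * (N - P x))\<close>. This is at least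
  \<open>D / 2\<close> once \<open>D\<close> times the mass on either side is at most
  \<open>\<rho> x\<close>, because the mass on the other side is at most \<open>N\<close>.\<close>

lemma artanh_coordinate_expands:
  fixes \<rho> :: "real \<Rightarrow> real"
  assumes "a < b" "D > 0"
    and cont: "continuous_on {a..b} \<rho>"
    and pos: "\<And>x. x \<in> {a..b} \<Longrightarrow> 0 < \<rho> x"
    and cheeger: "\<And>x. x \<in> {a<..<b} \<Longrightarrow>
      D * integral {a..x} \<rho> \<le> \<rho> x \<or> D * integral {x..b} \<rho> \<le> \<rho> x"
  defines "p \<equiv> (\<lambda>x. 2 * integral {a..x} \<rho> / integral {a..b} \<rho> - 1)"
  assumes x: "x \<in> {a<..<b}" and y: "y \<in> {a<..<b}"
  shows "D / 2 * \<bar>x - y\<bar> \<le> \<bar>artanh (p x) - artanh (p y)\<bar>"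
proof -
  define P where "P = (\<lambda>x. integral {a..x} \<rho>)"
  define N where "N = P b"
  note P = integral_fun_pos[OF \<open>a < b\<close> cont pos P_def, simplified]
  have p_def': "p = (\<lambda>x. 2 * P x / N - 1)"
    by (simp add: p_def N_def P_def)
  have range: "0 < P x" "P x < N" if "x \<in> {a<..<b}" for x
    using strict_mono_onD[OF P(3), of a x] strict_mono_onD[OF P(3), of x b] that P(2)
    by (auto simp: N_def)
  have tail: "integral {x..b} \<rho> = N - P x" if "x \<in> {a<..<b}" for x
    using Henstock_Kurzweil_Integration.integral_combine[of a x b \<rho>] that
    by (simp add: N_def P_def integrable_continuous_real cont algebra_simps)
  have main: "D / 2 * (y - x) \<le> artanh (p y) - artanh (p x)"
    if xy: "x \<in> {a<..<b}" "y \<in> {a<..<b}" "x \<le> y" for x y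
  proof -
    have "artanh (p x) - D / 2 * x \<le> artanh (p y) - D / 2 * y"
    proof (rule DERIV_nonneg_imp_nondecreasing[OF xy(3)])
      fix t assume "x \<le> t" "t \<le> y"
      then have t: "t \<in> {a<..<b}" using xy by auto
      note r = range[OF t]
      have N: "0 < N" using r by simp
      have bd: "\<bar>p t\<bar> < 1"
        using r N by (auto simp: p_def' abs_less_iff field_simps)
      have dP: "(P has_real_derivative \<rho> t) (at t)"
        using P(4) t by auto
      have dp: "(p has_real_derivative 2 * \<rho> t / N) (at t)"
        unfolding p_def' by (rule derivative_eq_intros dP refl | use N in simp)+
      have "((\<lambda>x. artanh (p x)) has_real_derivative 1 / (1 - (p t)\<^sup>2) * (2 * \<rho> t / N)) (at t)"
        by (rule DERIV_chain2[OF artanh_real_has_field_derivative dp]) (use bd in auto)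
      then have "((\<lambda>x. artanh (p x) - D / 2 * x) has_real_derivative
          1 / (1 - (p t)\<^sup>2) * (2 * \<rho> t / N) - D / 2) (at t)"
        by (rule DERIV_diff) (auto intro!: derivative_eq_intros)
      moreover have "1 / (1 - (p t)\<^sup>2) * (2 * \<rho> t / N) = \<rho> t * N / (2 * P t * (N - P t))"
      proof -
        have "1 - (p t)\<^sup>2 = 4 * P t * (N - P t) / N\<^sup>2"
          using N by (simp add: p_def' power2_eq_square field_simps)
        then show ?thesis
          using N r by (simp only:) (simp add: power2_eq_square field_simps)
      qed
      moreover have "D / 2 \<le> \<rho> t * N / (2 * P t * (N - P t))"
      proof -
        have "D * P t \<le> \<rho> t \<or> D * (N - P t) \<le> \<rho> t"
          using cheeger[OF t] tail[OF t] by (simp add: P_def)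
        then have "D * P t * (N - P t) \<le> \<rho> t * N"
        proof
          assume "D * P t \<le> \<rho> t"
          then have "D * P t * (N - P t) \<le> \<rho> t * (N - P t)"
            using r by (intro mult_right_mono) auto
          also have "\<dots> \<le> \<rho> t * N"
            using r pos[of t] t by (intro mult_left_mono) auto
          finally show ?thesis .
        next
          assume "D * (N - P t) \<le> \<rho> t"
          then have "D * (N - P t) * P t \<le> \<rho> t * P t"
            using r by (intro mult_right_mono) auto
          also have "\<dots> \<le> \<rho> t * N"
            using r pos[of t] t by (intro mult_left_mono) auto
          finally show ?thesis by (simp add: mult_ac)
        qed
        then show ?thesis
          using r by (simp add: field_simps)
      qed
      ultimately show "\<exists>d. ((\<lambda>x. artanh (p x) - D / 2 * x) has_real_derivative d) (at t) \<and> 0 \<le> d"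
        by (intro exI conjI) (auto)
    qed
    then show ?thesis by (simp add: field_simps)
  qed
  show ?thesis
  proof (cases "x \<le> y")
    case True
    with main[OF x y] show ?thesis
      by (simp add: abs_if)
  next
    case False
    with main[OF y x] show ?thesis
      by (auto simp: abs_real_def)
  qed
qed

text \<open>Let \<open>I\<close>, \<open>J\<close>, \<open>N\<close> be the masses of
  \<open>u * \<rho>\<close>, \<open>v * \<rho>\<close>, \<open>\<rho>\<close>. A midpoint function
  \<open>\<Psi>\<close> climbs from -1 to 1 with derivative at least
  \<open>2 / N * sqrt (J / I) * (u x * \<rho> x)\<close>; integrating gives
  \<open>sqrt (I * J) \<le> N\<close>.\<close>

lemma integral_mult_integral_le:
  fixes \<rho> u v :: "real \<Rightarrow> real"
  assumes ab: "a < b" and "D > 0"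
    and cont: "continuous_on {a..b} \<rho>" "continuous_on {a..b} u" "continuous_on {a..b} v"
    and pos: "\<And>x. x \<in> {a..b} \<Longrightarrow> 0 < \<rho> x"
      "\<And>x. x \<in> {a..b} \<Longrightarrow> 0 < u x" "\<And>x. x \<in> {a..b} \<Longrightarrow> 0 < v x"
    and cheeger: "\<And>x. x \<in> {a<..<b} \<Longrightarrow>
      D * integral {a..x} \<rho> \<le> \<rho> x \<or> D * integral {x..b} \<rho> \<le> \<rho> x"
    and cost: "\<And>x y. x \<in> {a..b} \<Longrightarrow> y \<in> {a..b} \<Longrightarrow>
      u x * v y \<le> exp (2 * (sqrt (1 + (D * (x - y) / 4)\<^sup>2) - 1))"
  shows "integral {a..b} (\<lambda>x. u x * \<rho> x) * integral {a..b} (\<lambda>x. v x * \<rho> x)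
    \<le> (integral {a..b} \<rho>)\<^sup>2"
proof -
  define P where "P = (\<lambda>x. integral {a..x} \<rho>)"
  define A where "A = (\<lambda>x. integral {a..x} (\<lambda>x. u x * \<rho> x))"
  define B where "B = (\<lambda>x. integral {a..x} (\<lambda>x. v x * \<rho> x))"
  define N where "N = P b"
  define I where "I = A b"
  define J where "J = B b"
  define p where "p = (\<lambda>x. 2 * P x / N - 1)"
  define s where "s = (\<lambda>x. arcsin (p x))"
  note P = integral_fun_pos[OF ab cont(1) pos(1) P_def, simplified]
  have uc: "continuous_on {a..b} (\<lambda>x. u x * \<rho> x)" "continuous_on {a..b} (\<lambda>x. v x * \<rho> x)"
    using cont by (auto intro: continuous_intros)
  have up: "0 < u x * \<rho> x" "0 < v x * \<rho> x" if "x \<in> {a..b}" for x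
    using pos that by auto
  note A = integral_fun_pos[OF ab uc(1) up(1) A_def, simplified]
  note B = integral_fun_pos[OF ab uc(2) up(2) B_def, simplified]
  have IJN: "0 < I" "0 < J" "0 < N"
    using strict_mono_onD[OF A(3), of a b] strict_mono_onD[OF B(3), of a b]
      strict_mono_onD[OF P(3), of a b] ab A(2) B(2) P(2) by (auto simp: I_def J_def N_def)
  have rangeP: "0 < P x" "P x < N" if "x \<in> {a<..<b}" for x
    using strict_mono_onD[OF P(3), of a x] strict_mono_onD[OF P(3), of x b] that P(2)
    by (auto simp: N_def)
  have rangeA: "0 < A x" "A x < I" if "x \<in> {a<..<b}" for x
    using strict_mono_onD[OF A(3), of a x] strict_mono_onD[OF A(3), of x b] that A(2)
    by (auto simp: I_def)
  have bd: "\<bar>p x\<bar> < 1" if "x \<in> {a<..<b}" for x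
    using rangeP[OF that] IJN by (auto simp: p_def abs_less_iff field_simps)
  have pab: "p a = -1" "p b = 1"
    using P(2) IJN by (auto simp: p_def N_def)
  have bdc: "p x \<in> {-1..1}" if "x \<in> {a..b}" for x
  proof (cases "x = a \<or> x = b")
    case False
    with bd[of x] that show ?thesis by (auto simp: abs_less_iff)
  qed (use pab in auto)

  \<comment> \<open>The inverse of the cumulative mass \<open>B\<close> of
    \<open>v * \<rho>\<close>; positivity of that density makes it differentiable inside its
    domain.\<close>
  define \<tau> where "\<tau> = inv_into {a..b} B"
  have injB: "inj_on B {a..b}"
    using B(3) by (rule strict_mono_on_imp_inj_on)
  have imB: "B ` {a..b} = {0..J}"
  proof
    have "B a \<le> B x" "B x \<le> B b" if "x \<in> {a..b}" for x
      using strict_mono_on_leD[OF B(3), of a x] strict_mono_on_leD[OF B(3), of x b] that by auto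
    then show "B ` {a..b} \<subseteq> {0..J}"
      using B(2) by (auto simp: J_def)
    show "{0..J} \<subseteq> B ` {a..b}"
      using IVT'[of B a _ b] ab B(1,2) by (fastforce simp: J_def image_iff)
  qed
  have \<tau>: "\<tau> z \<in> {a..b}" "B (\<tau> z) = z" if "z \<in> {0..J}" for z
    using that imB unfolding \<tau>_def by (auto intro: f_inv_into_f simp: inv_into_into
      simp del: atLeastAtMost_iff)
  have \<tau>B: "\<tau> (B x) = x" if "x \<in> {a..b}" for x
    using that injB by (simp add: \<tau>_def inv_into_f_f)
  have cont\<tau>: "continuous_on {0..J} \<tau>"
    using continuous_on_inv[OF B(1) compact_Icc, of \<tau>] \<tau>B by (simp add: imB)
  have \<tau>_int: "\<tau> z \<in> {a<..<b}" if "z \<in> {0<..<J}" for z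
  proof -
    have "B (\<tau> z) \<noteq> B a" "B (\<tau> z) \<noteq> B b"
      using \<tau>[of z] that B(2) by (auto simp: J_def)
    then have "\<tau> z \<noteq> a" "\<tau> z \<noteq> b" by auto
    with \<tau>(1)[of z] that show ?thesis by auto
  qed
  have der\<tau>: "(\<tau> has_real_derivative inverse (v (\<tau> z) * \<rho> (\<tau> z))) (at z)"
    if z: "z \<in> {0<..<J}" for z
  proof (rule DERIV_inverse_function[of B])
    show "(B has_real_derivative v (\<tau> z) * \<rho> (\<tau> z)) (at (\<tau> z))"
      using B(4)[of "\<tau> z"] \<tau>_int[OF z] by auto
    show "v (\<tau> z) * \<rho> (\<tau> z) \<noteq> 0"
      using up(2)[of "\<tau> z"] \<tau>_int[OF z] by auto
    show "isCont \<tau> z"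
      using cont\<tau> z by (simp add: continuous_on_interior interior_atLeastAtMost_real)
  qed (use z \<tau>(2) in auto)

  \<comment> \<open>\<open>\<sigma>\<close> transports the normalised density \<open>u \<rho>\<close> to \<open>v \<rho>\<close>; \<open>(1 + \<Psi>)/2\<close> is the \<open>\<rho>\<close>-mass to the left of
    the midpoint of \<open>x\<close> and \<open>\<sigma> x\<close> in the coordinate \<open>s\<close>.\<close>
  define \<sigma> where "\<sigma> = (\<lambda>x. \<tau> (A x * J / I))"
  define \<Psi> where "\<Psi> = (\<lambda>x. sin ((s x + s (\<sigma> x)) / 2))"
  have arg: "A x * J / I \<in> {0..J}" if "x \<in> {a..b}" for x
  proof -
    have "0 \<le> A x" "A x \<le> I"
      using strict_mono_on_leD[OF A(3), of a x] strict_mono_on_leD[OF A(3), of x b] that A(2)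
      by (auto simp: I_def)
    then show ?thesis
      using IJN by (auto simp: field_simps)
  qed
  have arg': "A x * J / I \<in> {0<..<J}" if "x \<in> {a<..<b}" for x
    using rangeA[OF that] IJN by (auto simp: field_simps)
  have cont_s: "continuous_on {a..b} s"
    unfolding s_def p_def using bdc P(1) IJN
    by (intro continuous_on_arcsin continuous_intros) (auto simp: p_def)
  have cont_\<sigma>: "continuous_on {a..b} \<sigma>"
    unfolding \<sigma>_def using IJN arg
    by (intro continuous_on_compose2[OF cont\<tau>] continuous_intros A(1)) auto
  have \<sigma>_mem: "\<sigma> ` {a..b} \<subseteq> {a..b}"
    using \<tau>(1) arg by (force simp: \<sigma>_def)
  have cont\<Psi>: "continuous_on {a..b} \<Psi>"
    unfolding \<Psi>_def using \<sigma>_mem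
    by (intro continuous_intros cont_s continuous_on_compose2[OF cont_s cont_\<sigma>]) auto
  have \<sigma>ab: "\<sigma> a = a" "\<sigma> b = b"
    using \<tau>B[of a] \<tau>B[of b] ab A(2) B(2) IJN by (auto simp: \<sigma>_def I_def J_def)
  have \<Psi>ab: "\<Psi> a = -1" "\<Psi> b = 1"
    by (auto simp: \<Psi>_def \<sigma>ab s_def pab)

  \<comment> \<open>The slope \<open>\<sigma>'\<close> of the transport carries the factor
    \<open>J / I\<close>, whose square root appears in the geometric mean of the two coordinate
    speeds; \<open>K * I\<close> is then \<open>sqrt (I * J)\<close>.\<close>
  define K where "K = sqrt (J / I)"
  \<comment> \<open>Derivatives are compared in the open interval, since \<open>p\<close> takes the
    values -1 and 1 at the endpoints and \<open>arcsin\<close> is not differentiable there;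
    continuity carries the comparison to the endpoints.\<close>
  have "\<Psi> a - 2 / N * K * A a \<le> \<Psi> b - 2 / N * K * A b"
  proof (rule DERIV_nonneg_imp_increasing_open[of a b])
    show "a \<le> b" using ab by simp
    show "continuous_on {a..b} (\<lambda>x. \<Psi> x - 2 / N * K * A x)"
      by (intro continuous_intros cont\<Psi> A(1))
    fix x assume "a < x" "x < b"
    then have x: "x \<in> {a<..<b}" by auto
    define y where "y = \<sigma> x"
    have y: "y \<in> {a<..<b}"
      using \<tau>_int[OF arg'[OF x]] by (simp add: y_def \<sigma>_def)
    define c where "c = (\<lambda>x. sqrt (1 - (p x)\<^sup>2))"
    have c: "0 < c x" "0 < c y"
      using bd[OF x] bd[OF y] by (auto simp: c_def abs_square_less_1)
    have ds: "(s has_real_derivative (2 * \<rho> t / N) / c t) (at t)" if t: "t \<in> {a<..<b}" for t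
    proof -
      have dP: "(P has_real_derivative \<rho> t) (at t)"
        using P(4) t by auto
      have dp: "(p has_real_derivative 2 * \<rho> t / N) (at t)"
        unfolding p_def by (rule derivative_eq_intros dP refl | use IJN in simp)+
      have "(s has_real_derivative inverse (sqrt (1 - (p t)\<^sup>2)) * (2 * \<rho> t / N)) (at t)"
        unfolding s_def by (rule DERIV_chain2[OF DERIV_arcsin dp]) (use bd[OF t] in auto)
      then show ?thesis by (simp add: c_def field_simps)
    qed
    define \<sigma>' where "\<sigma>' = inverse (v y * \<rho> y) * (u x * \<rho> x * J / I)"
    have dA: "(A has_real_derivative u x * \<rho> x) (at x)"
      using A(4) x by auto
    have "((\<lambda>x. A x * J / I) has_real_derivative u x * \<rho> x * J / I) (at x)"
      by (rule derivative_eq_intros dA refl | use IJN in simp)+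
    from DERIV_chain2[where f = \<tau> and g = "\<lambda>x. A x * J / I", OF der\<tau>[OF arg'[OF x]] this]
    have d\<sigma>: "(\<sigma> has_real_derivative \<sigma>') (at x)"
      unfolding \<sigma>_def \<sigma>'_def y_def .
    have ds\<sigma>: "((\<lambda>x. s (\<sigma> x)) has_real_derivative (2 * \<rho> y / N) / c y * \<sigma>') (at x)"
      by (rule DERIV_chain2[OF _ d\<sigma>]) (use ds[OF y] in \<open>simp add: y_def\<close>)
    define m where "m = (s x + s y) / 2"
    define \<alpha> where "\<alpha> = (2 * \<rho> x / N) / c x"
    define \<beta> where "\<beta> = (2 * \<rho> y / N) / c y * \<sigma>'"
    have d\<Psi>: "(\<Psi> has_real_derivative cos m * ((\<alpha> + \<beta>) / 2)) (at x)"
      unfolding \<Psi>_def m_def y_def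
      by (rule DERIV_chain2[OF DERIV_sin])
        (use DERIV_cdivide[OF DERIV_add[OF ds[OF x] ds\<sigma>], of 2] in \<open>simp add: \<alpha>_def \<beta>_def\<close>)
    have xy: "0 < \<rho> x" "0 < \<rho> y" "0 < u x" "0 < v y"
      using pos x y by auto
    have \<sigma>'0: "0 < \<sigma>'"
      using xy IJN by (simp add: \<sigma>'_def)
    have \<alpha>\<beta>: "0 < \<alpha>" "0 < \<beta>"
      using xy IJN c \<sigma>'0 by (simp_all add: \<alpha>_def \<beta>_def)
    have m_bd: "0 \<le> cos m"
      unfolding m_def s_def using arcsin_bounded[of "p x"] arcsin_bounded[of "p y"] bdc[of x] bdc[of y] x y
      by (intro cos_ge_zero) auto
    \<comment> \<open>The cost is bounded by a squared \<open>cosh\<close>, the distance of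
      \<open>x\<close> and \<open>y\<close> by their distance in the \<open>artanh\<close>
      coordinate, and the midpoint identity converts the result into
      \<open>(cos m)\<^sup>2\<close>.\<close>
    have gap: "u x * v y * (c x * c y) \<le> (cos m)\<^sup>2"
    proof -
      have "u x * v y \<le> (exp (sqrt (1 + (D * (x - y) / 4)\<^sup>2) - 1))\<^sup>2"
        using cost[of x y] x y by (simp flip: exp_double)
      also have "\<dots> \<le> (cosh (D * (x - y) / 4))\<^sup>2"
        by (intro power_mono exp_sqrt_le_cosh) auto
      also have "\<dots> \<le> (cosh ((artanh (p x) - artanh (p y)) / 2))\<^sup>2"
      proof -
        have "D / 2 * \<bar>x - y\<bar> \<le> \<bar>artanh (p x) - artanh (p y)\<bar>"
          using artanh_coordinate_expands[OF ab \<open>D > 0\<close> cont(1) pos(1) cheeger x y]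
          by (simp add: p_def P_def N_def)
        then have "\<bar>D * (x - y) / 4\<bar> \<le> \<bar>(artanh (p x) - artanh (p y)) / 2\<bar>"
          using \<open>D > 0\<close> by (simp add: abs_mult)
        then have "cosh \<bar>D * (x - y) / 4\<bar> \<le> cosh \<bar>(artanh (p x) - artanh (p y)) / 2\<bar>"
          by (subst cosh_real_nonneg_le_iff) auto
        then show ?thesis
          unfolding cosh_real_abs by (intro power_mono) auto
      qed
      finally have "u x * v y \<le> (cosh ((artanh (p x) - artanh (p y)) / 2))\<^sup>2" .
      then have "u x * v y * (c x * c y) \<le> (cosh ((artanh (p x) - artanh (p y)) / 2))\<^sup>2 * (c x * c y)"
        using c by (intro mult_right_mono) auto
      also have "\<dots> = (cos m)\<^sup>2"
        using cos_arcsin_midpoint[OF bd[OF x] bd[OF y]] by (simp add: m_def s_def c_def mult_ac)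
      finally show ?thesis .
    qed
    \<comment> \<open>Arithmetic-geometric mean inequality for the speeds \<open>\<alpha>\<close> of
      \<open>s x\<close> and \<open>\<beta>\<close> of \<open>s (\<sigma> x)\<close>. In their
      product \<open>\<rho> y\<close> cancels, and multiplying by the left side of
      \<open>gap\<close> gives exactly the square of the bound sought.\<close>
    have "2 / N * K * (u x * \<rho> x) \<le> cos m * ((\<alpha> + \<beta>) / 2)"
    proof (rule power2_le_imp_le)
      have "(2 / N * K * (u x * \<rho> x))\<^sup>2 = u x * v y * (c x * c y) * (\<alpha> * \<beta>)"
        using IJN xy c by (simp add: K_def \<alpha>_def \<beta>_def \<sigma>'_def power_mult_distrib)
          (simp add: field_simps power2_eq_square)
      also have "\<dots> \<le> (cos m)\<^sup>2 * (\<alpha> * \<beta>)"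
        using gap \<alpha>\<beta> by (intro mult_right_mono) auto
      also have "\<dots> \<le> (cos m)\<^sup>2 * ((\<alpha> + \<beta>) / 2)\<^sup>2"
      proof -
        have "0 \<le> (\<alpha> - \<beta>)\<^sup>2" by simp
        then have "\<alpha> * \<beta> \<le> ((\<alpha> + \<beta>) / 2)\<^sup>2"
          by (simp add: power2_eq_square field_simps)
        then show ?thesis by (intro mult_left_mono) auto
      qed
      finally show "(2 / N * K * (u x * \<rho> x))\<^sup>2 \<le> (cos m * ((\<alpha> + \<beta>) / 2))\<^sup>2"
        by (simp only: power_mult_distrib[of "cos m"])
      show "0 \<le> cos m * ((\<alpha> + \<beta>) / 2)"
        using m_bd \<alpha>\<beta> by simp
    qed
    then show "\<exists>d. ((\<lambda>x. \<Psi> x - 2 / N * K * A x) has_real_derivative d) (at x) \<and> 0 \<le> d"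
      using DERIV_diff[OF d\<Psi> DERIV_cmult[OF dA, of "2 / N * K"]] by (intro exI conjI) auto
  qed
  then have "2 / N * K * I \<le> 2"
    using A(2) by (simp add: \<Psi>ab I_def)
  then have "K * I \<le> N"
    using IJN by (simp add: field_simps)
  then have "(K * I)\<^sup>2 \<le> N\<^sup>2"
    using IJN by (intro power_mono) (auto simp: K_def)
  moreover have "(K * I)\<^sup>2 = I * J"
    using IJN by (simp add: K_def power_mult_distrib) (simp add: power2_eq_square)
  ultimately show ?thesis
    by (simp add: I_def J_def N_def A_def B_def P_def)
qed

section \<open>Passage from continuous functions to extended nonnegative functions with Lipschitz
  logarithm\<close>

lemma continuous_on_log_Lipschitz:
  fixes f :: "real \<Rightarrow> real"
  assumes "0 \<le> L" and pos: "\<And>s. s \<in> S \<Longrightarrow> 0 < f s"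
    and lip: "\<And>s t. s \<in> S \<Longrightarrow> t \<in> S \<Longrightarrow> f s \<le> exp (L * \<bar>s - t\<bar>) * f t"
  shows "continuous_on S f"
proof -
  have ln_le: "ln (f s) - ln (f t) \<le> L * \<bar>s - t\<bar>" if st: "s \<in> S" "t \<in> S" for s t
  proof -
    have "ln (f s) \<le> ln (exp (L * \<bar>s - t\<bar>) * f t)"
      using lip[OF st] pos[OF st(1)] by (intro ln_mono) auto
    also have "\<dots> = L * \<bar>s - t\<bar> + ln (f t)"
      using pos[OF st(2)] by (simp add: ln_mult)
    finally show ?thesis by simp
  qed
  have "L-lipschitz_on S (\<lambda>s. ln (f s))"
  proof (rule lipschitz_onI)
    show "dist (ln (f s)) (ln (f t)) \<le> L * dist s t" if "s \<in> S" "t \<in> S" for s t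
      using ln_le[OF that] ln_le[OF that(2) that(1)]
      by (simp add: dist_real_def abs_le_iff abs_minus_commute)
  qed fact
  then have "continuous_on S (\<lambda>s. exp (ln (f s)))"
    by (intro continuous_on_exp lipschitz_on_continuous_on)
  then show ?thesis
    by (rule continuous_on_eq) (simp add: pos)
qed

text \<open>The point \<open>z\<close> allows the density to differ from its continuous
  representative on a Lebesgue null set; in the application it is the origin.\<close>

lemma nn_integral_density_continuous:
  fixes \<rho> \<rho>' f :: "real \<Rightarrow> real" and u :: "real \<Rightarrow> ennreal"
  assumes [measurable]: "\<rho> \<in> borel_measurable borel" "u \<in> borel_measurable borel"
    and eq: "\<And>x. x \<in> {a..b} \<Longrightarrow> x \<noteq> z \<Longrightarrow> \<rho> x = \<rho>' x"
    and nonneg: "\<And>x. x \<in> {a..b} \<Longrightarrow> 0 \<le> \<rho>' x" "\<And>x. x \<in> {a..b} \<Longrightarrow> 0 \<le> f x"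
    and cont: "continuous_on {a..b} \<rho>'" "continuous_on {a..b} f"
    and u: "\<And>x. x \<notin> {a..b} \<Longrightarrow> u x = 0" "\<And>x. x \<in> {a..b} \<Longrightarrow> u x = ennreal (f x)"
  shows "(\<integral>\<^sup>+x. u x \<partial>density lborel (\<lambda>x. ennreal (\<rho> x))) = ennreal (integral {a..b} (\<lambda>x. f x * \<rho>' x))"
proof -
  have "(\<integral>\<^sup>+x. u x \<partial>density lborel (\<lambda>x. ennreal (\<rho> x))) = (\<integral>\<^sup>+x. ennreal (\<rho> x) * u x \<partial>lborel)"
    by (subst nn_integral_density) auto
  also have "\<dots> = (\<integral>\<^sup>+x. ennreal (f x * \<rho>' x) * indicator {a..b} x \<partial>lborel)"
  proof (rule nn_integral_cong_AE)
    show "AE x in lborel. ennreal (\<rho> x) * u x = ennreal (f x * \<rho>' x) * indicator {a..b} x"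
      using AE_lborel_singleton[of z]
    proof eventually_elim
      case (elim x)
      then show ?case
        using u eq nonneg by (cases "x \<in> {a..b}") (auto simp: ennreal_mult' mult.commute)
    qed
  qed
  also have "\<dots> = ennreal (integral {a..b} (\<lambda>x. f x * \<rho>' x))"
    using nonneg cont
    by (intro nn_integral_has_integral_lebesgue' integrable_integral integrable_continuous_real
        continuous_intros) auto
  finally show ?thesis .
qed

text \<open>The Lipschitz bound makes each of \<open>u\<close> and \<open>v\<close> vanish
  everywhere or nowhere on the interval. If neither vanishes, the finite cost excludes the value
  \<open>\<top>\<close>, so both have positive continuous real representatives, and dividing the
  first by \<open>K\<close> reduces to cost constant 1. This is the form that tensorisation takes as
  its one-dimensional hypothesis.\<close>

lemma nn_integral_mult_nn_integral_le:
  fixes \<rho> \<rho>' :: "real \<Rightarrow> real" and u v :: "real \<Rightarrow> ennreal"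
  assumes ab: "a < b" and D: "D > 0" and L: "0 \<le> L" and K: "0 < K"
    and meas: "\<rho> \<in> borel_measurable borel" "u \<in> borel_measurable borel" "v \<in> borel_measurable borel"
    and eq: "\<And>x. x \<in> {a..b} \<Longrightarrow> x \<noteq> z \<Longrightarrow> \<rho> x = \<rho>' x"
    and pos: "\<And>x. x \<in> {a..b} \<Longrightarrow> 0 < \<rho>' x"
    and cont: "continuous_on {a..b} \<rho>'"
    and mass: "integral {a..b} \<rho>' \<le> 1"
    and cheeger: "\<And>x. x \<in> {a<..<b} \<Longrightarrow>
      D * integral {a..x} \<rho>' \<le> \<rho>' x \<or> D * integral {x..b} \<rho>' \<le> \<rho>' x"
    and supp: "\<And>s. s \<notin> {a..b} \<Longrightarrow> u s = 0" "\<And>s. s \<notin> {a..b} \<Longrightarrow> v s = 0"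
    and lip: "\<And>s t. s \<in> {a..b} \<Longrightarrow> t \<in> {a..b} \<Longrightarrow> u s \<le> ennreal (exp (L * \<bar>s - t\<bar>)) * u t"
      "\<And>s t. s \<in> {a..b} \<Longrightarrow> t \<in> {a..b} \<Longrightarrow> v s \<le> ennreal (exp (L * \<bar>s - t\<bar>)) * v t"
    and cost: "\<And>s t. s \<in> {a..b} \<Longrightarrow> t \<in> {a..b} \<Longrightarrow>
      u s * v t \<le> ennreal (K * exp (2 * (sqrt (1 + (D * (s - t) / 4)\<^sup>2) - 1)))"
  shows "(\<integral>\<^sup>+s. u s \<partial>density lborel (\<lambda>x. ennreal (\<rho> x))) *
    (\<integral>\<^sup>+s. v s \<partial>density lborel (\<lambda>x. ennreal (\<rho> x))) \<le> ennreal K"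
proof (cases "(\<forall>s. u s = 0) \<or> (\<forall>s. v s = 0)")
  case True
  then show ?thesis by auto
next
  case False
  then obtain p q where p: "p \<in> {a..b}" "u p \<noteq> 0" and q: "q \<in> {a..b}" "v q \<noteq> 0"
    using supp by metis
  have u0: "u s \<noteq> 0" if "s \<in> {a..b}" for s
    using lip(1)[OF p(1) that] p(2) by auto
  have v0: "v s \<noteq> 0" if "s \<in> {a..b}" for s
    using lip(2)[OF q(1) that] q(2) by auto
  have utop: "u s \<noteq> \<top>" "v s \<noteq> \<top>" if "s \<in> {a..b}" for s
    using cost[OF that that] u0[OF that] v0[OF that]
    by (auto simp: ennreal_top_mult ennreal_mult_top top_unique)
  define f where "f = (\<lambda>s. enn2real (u s))"
  define g where "g = (\<lambda>s. enn2real (v s))"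
  have uf: "u s = ennreal (f s)" "v s = ennreal (g s)" if "s \<in> {a..b}" for s
    using utop[OF that] by (auto simp: f_def g_def less_top)
  have fpos: "0 < f s" "0 < g s" if "s \<in> {a..b}" for s
    using utop[OF that] u0[OF that] v0[OF that]
    by (auto simp: f_def g_def enn2real_positive_iff less_top zero_less_iff_neq_zero)
  have f_lip: "f s \<le> exp (L * \<bar>s - t\<bar>) * f t" "g s \<le> exp (L * \<bar>s - t\<bar>) * g t"
    if "s \<in> {a..b}" "t \<in> {a..b}" for s t
    using lip(1)[OF that] lip(2)[OF that] uf[OF that(1)] uf[OF that(2)] fpos[OF that(2)] fpos[OF that(1)]
    by (simp_all add: ennreal_le_iff flip: ennreal_mult)
  have f_cont: "continuous_on {a..b} f" "continuous_on {a..b} g"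
    by (rule continuous_on_log_Lipschitz[OF L fpos(1) f_lip(1)], assumption+)
      (rule continuous_on_log_Lipschitz[OF L fpos(2) f_lip(2)], assumption+)
  have fg: "f s * g t \<le> K * exp (2 * (sqrt (1 + (D * (s - t) / 4)\<^sup>2) - 1))"
    if "s \<in> {a..b}" "t \<in> {a..b}" for s t
    using cost[OF that] uf[OF that(1)] uf[OF that(2)] fpos[OF that(1)] fpos[OF that(2)] K
    by (simp add: ennreal_le_iff flip: ennreal_mult)
  have "integral {a..b} (\<lambda>x. f x / K * \<rho>' x) * integral {a..b} (\<lambda>x. g x * \<rho>' x)
      \<le> (integral {a..b} \<rho>')\<^sup>2"
  proof (rule integral_mult_integral_le[OF ab D cont])
    show "f x / K * g y \<le> exp (2 * (sqrt (1 + (D * (x - y) / 4)\<^sup>2) - 1))"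
      if "x \<in> {a..b}" "y \<in> {a..b}" for x y
      using fg[OF that] K by (simp add: field_simps)
  qed (use f_cont fpos pos K cheeger in \<open>auto intro!: continuous_intros\<close>)
  also have "\<dots> \<le> 1"
    using mass pos ab
    by (intro power_le_one integral_nonneg integrable_continuous_real cont) (auto intro: less_imp_le)
  also have "integral {a..b} (\<lambda>x. f x / K * \<rho>' x) = integral {a..b} (\<lambda>x. f x * \<rho>' x) / K"
    by simp
  finally have "integral {a..b} (\<lambda>x. f x * \<rho>' x) * integral {a..b} (\<lambda>x. g x * \<rho>' x) \<le> K"
    using K by (simp add: field_simps)
  moreover have "0 \<le> integral {a..b} (\<lambda>x. f x * \<rho>' x)"
    using fpos pos
    by (intro integral_nonneg integrable_continuous_real continuous_intros cont f_cont)
      (auto intro!: mult_nonneg_nonneg intro: less_imp_le)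
  moreover have "(\<integral>\<^sup>+s. u s \<partial>density lborel (\<lambda>x. ennreal (\<rho> x))) = ennreal (integral {a..b} (\<lambda>x. f x * \<rho>' x))"
    "(\<integral>\<^sup>+s. v s \<partial>density lborel (\<lambda>x. ennreal (\<rho> x))) = ennreal (integral {a..b} (\<lambda>x. g x * \<rho>' x))"
    by (rule nn_integral_density_continuous[OF meas(1,2) eq less_imp_le[OF pos] less_imp_le[OF fpos(1)]
          cont f_cont(1) supp(1) uf(1)], assumption+)
      (rule nn_integral_density_continuous[OF meas(1,3) eq less_imp_le[OF pos] less_imp_le[OF fpos(2)]
          cont f_cont(2) supp(2) uf(2)], assumption+)
  ultimately show ?thesis
    by (simp add: ennreal_leI flip: ennreal_mult')
qed

subsection \<open>Tensorisation and concentration on a cube\<close>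

text \<open>
  The Lipschitz condition on \<open>log u\<close> and \<open>log v\<close> in each coordinate is inherited by partial
  integrals, so that no infimum convolutions (and no measurability questions about them) arise.
\<close>

lemma nn_integral_PiM_mult_le:
  fixes M :: "real measure" and c :: "real \<Rightarrow> real \<Rightarrow> real" and I :: "'i set"
  assumes sf: "sigma_finite_measure M" and M: "sets M = sets borel"
    and one: "\<And>u v K. u \<in> borel_measurable borel \<Longrightarrow> v \<in> borel_measurable borel \<Longrightarrow>
      (\<And>s. s \<notin> S \<Longrightarrow> u s = 0) \<Longrightarrow> (\<And>s. s \<notin> S \<Longrightarrow> v s = 0) \<Longrightarrow>
      (\<And>s t. s \<in> S \<Longrightarrow> t \<in> S \<Longrightarrow> u s \<le> ennreal (exp (L * \<bar>s - t\<bar>)) * u t) \<Longrightarrow>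
      (\<And>s t. s \<in> S \<Longrightarrow> t \<in> S \<Longrightarrow> v s \<le> ennreal (exp (L * \<bar>s - t\<bar>)) * v t) \<Longrightarrow>
      0 < K \<Longrightarrow>
      (\<And>s t. s \<in> S \<Longrightarrow> t \<in> S \<Longrightarrow> u s * v t \<le> ennreal (K * exp (c s t))) \<Longrightarrow>
      (\<integral>\<^sup>+s. u s \<partial>M) * (\<integral>\<^sup>+s. v s \<partial>M) \<le> ennreal K"
    and "finite I"
    and "u \<in> borel_measurable (PiM I (\<lambda>_. M))" "v \<in> borel_measurable (PiM I (\<lambda>_. M))"
    and "\<And>x i. x \<in> extensional I \<Longrightarrow> i \<in> I \<Longrightarrow> x i \<notin> S \<Longrightarrow> u x = 0"
    and "\<And>x i. x \<in> extensional I \<Longrightarrow> i \<in> I \<Longrightarrow> x i \<notin> S \<Longrightarrow> v x = 0"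
    and "\<And>x i s t. x \<in> extensional I \<Longrightarrow> i \<in> I \<Longrightarrow> s \<in> S \<Longrightarrow> t \<in> S \<Longrightarrow>
      u (x(i := s)) \<le> ennreal (exp (L * \<bar>s - t\<bar>)) * u (x(i := t))"
    and "\<And>x i s t. x \<in> extensional I \<Longrightarrow> i \<in> I \<Longrightarrow> s \<in> S \<Longrightarrow> t \<in> S \<Longrightarrow>
      v (x(i := s)) \<le> ennreal (exp (L * \<bar>s - t\<bar>)) * v (x(i := t))"
    and "0 < K"
    and "\<And>x y. x \<in> Pi\<^sub>E I (\<lambda>_. S) \<Longrightarrow> y \<in> Pi\<^sub>E I (\<lambda>_. S) \<Longrightarrow>
      u x * v y \<le> ennreal (K * exp (\<Sum>i\<in>I. c (x i) (y i)))"
  shows "(\<integral>\<^sup>+x. u x \<partial>PiM I (\<lambda>_. M)) * (\<integral>\<^sup>+x. v x \<partial>PiM I (\<lambda>_. M)) \<le> ennreal K"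
  using \<open>finite I\<close> assms(5-)
proof (induction I arbitrary: u v K rule: finite_induct)
  case empty
  interpret product_sigma_finite "\<lambda>_. M"
    by (simp add: product_sigma_finite_def sf)
  show ?case
    using empty.prems(8)[of "\<lambda>_. undefined" "\<lambda>_. undefined"]
    by (simp add: nn_integral_empty)
next
  case (insert i I)
  interpret product_sigma_finite "\<lambda>_. M"
    by (simp add: product_sigma_finite_def sf)
  interpret sigma_finite_measure M by fact
  have space: "space M = UNIV"
    using sets_eq_imp_space_eq[OF M] by simp
  have upd_meas: "(\<lambda>t. f (x(i := t))) \<in> borel_measurable borel"
    if f: "f \<in> borel_measurable (PiM (insert i I) (\<lambda>_. M))" and x: "x \<in> extensional I"
    for f :: "('i \<Rightarrow> real) \<Rightarrow> ennreal" and x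
  proof -
    have "(\<lambda>t. x(i := t)) \<in> M \<rightarrow>\<^sub>M PiM (insert i I) (\<lambda>_. M)"
      using x by (intro measurable_fun_upd[where J = I]) (auto simp: space_PiM PiE_def space)
    then have "(\<lambda>t. f (x(i := t))) \<in> borel_measurable M"
      using f by (rule measurable_compose)
    then show ?thesis using M by (simp cong: measurable_cong_sets)
  qed
  have int_meas: "(\<lambda>x. \<integral>\<^sup>+t. f (x(i := t)) \<partial>M) \<in> borel_measurable (PiM I (\<lambda>_. M))"
    if f: "f \<in> borel_measurable (PiM (insert i I) (\<lambda>_. M))"
    for f :: "('i \<Rightarrow> real) \<Rightarrow> ennreal"
  proof (rule borel_measurable_nn_integral)
    show "(\<lambda>(x, t). f (x(i := t))) \<in> borel_measurable (PiM I (\<lambda>_. M) \<Otimes>\<^sub>M M)"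
      using measurable_compose[OF measurable_add_dim f] by (simp add: split_def)
  qed
  have ext: "x(i := t) \<in> extensional (insert i I)" if "x \<in> extensional I" for x and t :: real
    using that by (auto simp: extensional_def)
  have lip: "(\<integral>\<^sup>+r. f ((x(j := s))(i := r)) \<partial>M) \<le>
      ennreal (exp (L * \<bar>s - t\<bar>)) * (\<integral>\<^sup>+r. f ((x(j := t))(i := r)) \<partial>M)"
    if f: "f \<in> borel_measurable (PiM (insert i I) (\<lambda>_. M))"
      and fl: "\<And>x j s t. x \<in> extensional (insert i I) \<Longrightarrow> j \<in> insert i I \<Longrightarrow> s \<in> S \<Longrightarrow> t \<in> S \<Longrightarrow>
        f (x(j := s)) \<le> ennreal (exp (L * \<bar>s - t\<bar>)) * f (x(j := t))"
      and x: "x \<in> extensional I" and j: "j \<in> I" and st: "s \<in> S" "t \<in> S"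
    for f :: "('i \<Rightarrow> real) \<Rightarrow> ennreal" and x j s t
  proof -
    have "i \<noteq> j" using j insert.hyps by auto
    have "x(j := t) \<in> extensional I" using x j by (auto simp: extensional_def)
    have "(\<integral>\<^sup>+r. f ((x(j := s))(i := r)) \<partial>M) \<le>
        (\<integral>\<^sup>+r. ennreal (exp (L * \<bar>s - t\<bar>)) * f ((x(j := t))(i := r)) \<partial>M)"
    proof (rule nn_integral_mono)
      fix r
      show "f ((x(j := s))(i := r)) \<le> ennreal (exp (L * \<bar>s - t\<bar>)) * f ((x(j := t))(i := r))"
        using fl[OF ext[OF x], of j s t r] j st \<open>i \<noteq> j\<close> by (simp add: fun_upd_twist)
    qed
    also have "\<dots> = ennreal (exp (L * \<bar>s - t\<bar>)) * (\<integral>\<^sup>+r. f ((x(j := t))(i := r)) \<partial>M)"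
      using upd_meas[OF f \<open>x(j := t) \<in> extensional I\<close>] M
      by (intro nn_integral_cmult) (simp cong: measurable_cong_sets)
    finally show ?thesis .
  qed
  define u1 where "u1 = (\<lambda>x. \<integral>\<^sup>+t. u (x(i := t)) \<partial>M)"
  define v1 where "v1 = (\<lambda>x. \<integral>\<^sup>+t. v (x(i := t)) \<partial>M)"
  have "(\<integral>\<^sup>+x. u1 x \<partial>PiM I (\<lambda>_. M)) * (\<integral>\<^sup>+x. v1 x \<partial>PiM I (\<lambda>_. M)) \<le> ennreal K"
  proof (rule insert.IH)
    show "u1 \<in> borel_measurable (PiM I (\<lambda>_. M))" "v1 \<in> borel_measurable (PiM I (\<lambda>_. M))"
      unfolding u1_def v1_def by (intro int_meas insert.prems)+
    show "u1 x = 0" if "x \<in> extensional I" "j \<in> I" "x j \<notin> S" for x j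
    proof -
      have "u (x(i := t)) = 0" for t
        by (rule insert.prems(3)[OF ext[OF that(1)], of j]) (use insert.hyps that in auto)
      then show ?thesis by (simp add: u1_def)
    qed
    show "v1 x = 0" if "x \<in> extensional I" "j \<in> I" "x j \<notin> S" for x j
    proof -
      have "v (x(i := t)) = 0" for t
        by (rule insert.prems(4)[OF ext[OF that(1)], of j]) (use insert.hyps that in auto)
      then show ?thesis by (simp add: v1_def)
    qed
    show "u1 (x(j := s)) \<le> ennreal (exp (L * \<bar>s - t\<bar>)) * u1 (x(j := t))"
      if "x \<in> extensional I" "j \<in> I" "s \<in> S" "t \<in> S" for x j s t
      unfolding u1_def using insert.prems(5) that by (intro lip insert.prems(1)) auto
    show "v1 (x(j := s)) \<le> ennreal (exp (L * \<bar>s - t\<bar>)) * v1 (x(j := t))"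
      if "x \<in> extensional I" "j \<in> I" "s \<in> S" "t \<in> S" for x j s t
      unfolding v1_def using insert.prems(6) that by (intro lip insert.prems(2)) auto
    show "0 < K" by fact
    \<comment> \<open>For fixed \<open>x\<close> and \<open>y\<close> the costs of the coordinates
      in \<open>I\<close> are part of the constant, so the one-dimensional hypothesis is applied
      with \<open>K * exp (\<Sum>i\<in>I. c (x i) (y i))\<close> in place of
      \<open>K\<close>.\<close>
    show "u1 x * v1 y \<le> ennreal (K * exp (\<Sum>i\<in>I. c (x i) (y i)))"
      if x: "x \<in> Pi\<^sub>E I (\<lambda>_. S)" and y: "y \<in> Pi\<^sub>E I (\<lambda>_. S)" for x y
      unfolding u1_def v1_def
    proof (rule one)
      have xe: "x \<in> extensional I" "y \<in> extensional I"
        using x y by (auto simp: PiE_def)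
      show "(\<lambda>t. u (x(i := t))) \<in> borel_measurable borel" "(\<lambda>t. v (y(i := t))) \<in> borel_measurable borel"
        by (intro upd_meas insert.prems xe)+
      show "u (x(i := s)) = 0" if "s \<notin> S" for s
        by (rule insert.prems(3)[OF ext[OF xe(1)], of i]) (use that in auto)
      show "v (y(i := s)) = 0" if "s \<notin> S" for s
        by (rule insert.prems(4)[OF ext[OF xe(2)], of i]) (use that in auto)
      show "u (x(i := s)) \<le> ennreal (exp (L * \<bar>s - t\<bar>)) * u (x(i := t))" if "s \<in> S" "t \<in> S" for s t
        using insert.prems(5)[OF ext[OF xe(1), of 0] insertI1 that] by (simp only: fun_upd_upd)
      show "v (y(i := s)) \<le> ennreal (exp (L * \<bar>s - t\<bar>)) * v (y(i := t))" if "s \<in> S" "t \<in> S" for s t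
        using insert.prems(6)[OF ext[OF xe(2), of 0] insertI1 that] by (simp only: fun_upd_upd)
      show "0 < K * exp (\<Sum>i\<in>I. c (x i) (y i))"
        using \<open>0 < K\<close> by simp
      show "u (x(i := s)) * v (y(i := t)) \<le>
          ennreal (K * exp (\<Sum>i\<in>I. c (x i) (y i)) * exp (c s t))" if "s \<in> S" "t \<in> S" for s t
      proof -
        have "(\<Sum>j\<in>insert i I. c ((x(i := s)) j) ((y(i := t)) j)) = c s t + (\<Sum>j\<in>I. c (x j) (y j))"
          using insert.hyps by (auto intro!: sum.cong)
        moreover have "u (x(i := s)) * v (y(i := t)) \<le>
            ennreal (K * exp (\<Sum>j\<in>insert i I. c ((x(i := s)) j) ((y(i := t)) j)))"
          by (intro insert.prems(8) PiE_fun_upd that x y)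
        ultimately show ?thesis
          by (simp only: exp_add mult_ac)
      qed
    qed
  qed
  then show ?case
    using insert.hyps insert.prems(1,2)
    by (simp add: u1_def v1_def product_nn_integral_insert)
qed

text \<open>The function \<open>sqrt (1 + t) - 1\<close> is concave and vanishes at 0, hence is
  subadditive for \<open>0 \<le> t\<close>; squaring reduces the two-term case to
  \<open>1 + p + q \<le> (1 + p) * (1 + q)\<close>. It bounds the sum of the coordinate costs below
  by a function of the Euclidean distance.\<close>

lemma sqrt_sum_le:
  fixes a :: "'i \<Rightarrow> real"
  assumes "finite I" "\<And>i. i \<in> I \<Longrightarrow> 0 \<le> a i"
  shows "sqrt (1 + (\<Sum>i\<in>I. a i)) - 1 \<le> (\<Sum>i\<in>I. sqrt (1 + a i) - 1)"
  using assms
proof (induction I rule: finite_induct)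
  case (insert i I)
  have two: "sqrt (1 + (p + q)) + 1 \<le> sqrt (1 + p) + sqrt (1 + q)" if "0 \<le> p" "0 \<le> q" for p q :: real
  proof (rule power2_le_imp_le)
    have "sqrt (1 + (p + q)) \<le> sqrt ((1 + p) * (1 + q))"
      using that by (intro real_sqrt_le_mono) (simp add: algebra_simps)
    also have "\<dots> = sqrt (1 + p) * sqrt (1 + q)"
      by (rule real_sqrt_mult)
    finally show "(sqrt (1 + (p + q)) + 1)\<^sup>2 \<le> (sqrt (1 + p) + sqrt (1 + q))\<^sup>2"
      using that by (simp add: power2_sum)
  qed (use that in auto)
  show ?case
    using insert.IH insert.hyps insert.prems two[of "a i" "sum a I"]
    by (simp add: sum_nonneg)
qed simp

text \<open>Composed with restriction to \<open>I\<close>, \<open>F\<close> is continuous for the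
  product topology on all functions, because the Euclidean norm is at most the sum of the absolute
  coordinates. Countability of the index type identifies the Borel sets of that topology with the
  product sigma-algebra, and extension by zero pulls measurability back.\<close>

lemma measurable_Lipschitz_PiM:
  fixes F :: "('i::countable \<Rightarrow> real) \<Rightarrow> real"
  assumes "finite I" and M: "sets M = sets borel"
    and lip: "\<And>x y. x \<in> extensional I \<Longrightarrow> y \<in> extensional I \<Longrightarrow>
      \<bar>F x - F y\<bar> \<le> L2_set (\<lambda>i. x i - y i) I"
  shows "F \<in> borel_measurable (PiM I (\<lambda>_. M))"
proof -
  define G where "G = (\<lambda>x. F (restrict x I))"
  have "continuous_on UNIV G"
    unfolding continuous_on_def
  proof (intro ballI)
    fix x :: "'i \<Rightarrow> real"
    have "((\<lambda>y. y i) \<longlongrightarrow> x i) (at x)" for i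
      using continuous_on_product_coordinates[of i] by (auto simp: continuous_on_def)
    then have "((\<lambda>y. \<Sum>i\<in>I. \<bar>y i - x i\<bar>) \<longlongrightarrow> (\<Sum>i\<in>I. \<bar>x i - x i\<bar>)) (at x)"
      by (intro tendsto_intros)
    then have lim: "((\<lambda>y. \<Sum>i\<in>I. \<bar>y i - x i\<bar>) \<longlongrightarrow> 0) (at x)"
      by simp
    have "((\<lambda>y. G y - G x) \<longlongrightarrow> 0) (at x)"
    proof (rule Lim_null_comparison[OF _ lim], rule always_eventually, rule allI)
      fix y
      have "norm (G y - G x) \<le> L2_set (\<lambda>i. restrict y I i - restrict x I i) I"
        using lip[of "restrict y I" "restrict x I"] by (simp add: G_def)
      also have "\<dots> = L2_set (\<lambda>i. y i - x i) I"
        by (rule L2_set_cong) auto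
      also have "\<dots> \<le> (\<Sum>i\<in>I. \<bar>y i - x i\<bar>)"
        by (rule L2_set_le_sum_abs)
      finally show "norm (G y - G x) \<le> (\<Sum>i\<in>I. \<bar>y i - x i\<bar>)" .
    qed
    then show "(G \<longlongrightarrow> G x) (at x within UNIV)"
      by (rule LIM_zero_cancel)
  qed
  then have G: "G \<in> borel_measurable (PiM UNIV (\<lambda>_. borel))"
    by (simp add: borel_measurable_continuous_onI sets_PiM_equal_borel cong: measurable_cong_sets)
  have "(\<lambda>x i. if i \<in> I then x i else 0) \<in> PiM I (\<lambda>_. M) \<rightarrow>\<^sub>M PiM UNIV (\<lambda>_. borel)"
  proof (rule measurable_PiM_single')
    fix i :: 'i
    show "(\<lambda>x. if i \<in> I then x i else 0) \<in> PiM I (\<lambda>_. M) \<rightarrow>\<^sub>M borel"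
    proof (cases "i \<in> I")
      case True
      then have "(\<lambda>x. x i) \<in> PiM I (\<lambda>_. M) \<rightarrow>\<^sub>M M"
        by (rule measurable_component_singleton)
      then show ?thesis
        using True M by (simp cong: measurable_cong_sets)
    qed simp
  qed auto
  from measurable_compose[OF this G]
  have "(\<lambda>x. G (\<lambda>i. if i \<in> I then x i else 0)) \<in> borel_measurable (PiM I (\<lambda>_. M))" .
  moreover have "G (\<lambda>i. if i \<in> I then x i else 0) = F x" if "x \<in> space (PiM I (\<lambda>_. M))" for x
  proof -
    have "restrict (\<lambda>i. if i \<in> I then x i else 0) I = x"
      using that by (auto simp: space_PiM PiE_def extensional_def restrict_def)
    then show ?thesis by (simp add: G_def)
  qed
  ultimately show ?thesis
    by (simp cong: measurable_cong)
qed

text \<open>An exponential Markov argument: \<open>u\<close> is at least 1 on the first set and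
  \<open>v\<close> at least \<open>exp (D / 2 * k - 2)\<close> on the second. The product form
  awaits a lower bound on the first factor, which a median will supply.\<close>

lemma cube_concentration:
  fixes \<rho> \<rho>' :: "real \<Rightarrow> real" and F :: "('i \<Rightarrow> real) \<Rightarrow> real" and I :: "'i set"
  assumes I: "finite I" and ab: "a < b" and D: "D > 0"
    and meas: "\<rho> \<in> borel_measurable borel"
    and M_def: "M = density lborel (\<lambda>x. ennreal (\<rho> x))"
    and prob: "prob_space M"
    and eq: "\<And>x. x \<in> {a..b} \<Longrightarrow> x \<noteq> z \<Longrightarrow> \<rho> x = \<rho>' x"
    and pos: "\<And>x. x \<in> {a..b} \<Longrightarrow> 0 < \<rho>' x"
    and cont: "continuous_on {a..b} \<rho>'"
    and mass: "integral {a..b} \<rho>' \<le> 1"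
    and cheeger: "\<And>x. x \<in> {a<..<b} \<Longrightarrow>
      D * integral {a..x} \<rho>' \<le> \<rho>' x \<or> D * integral {x..b} \<rho>' \<le> \<rho>' x"
    and F [measurable]: "F \<in> borel_measurable (PiM I (\<lambda>_. M))"
    and lip: "\<And>x y. x \<in> extensional I \<Longrightarrow> y \<in> extensional I \<Longrightarrow>
      \<bar>F x - F y\<bar> \<le> L2_set (\<lambda>i. x i - y i) I"
  defines "Q \<equiv> PiM I (\<lambda>_. M)" and "cube \<equiv> Pi\<^sub>E I (\<lambda>_. {a..b})"
  shows "measure Q {x \<in> cube. F x \<le> m} * measure Q {x \<in> cube. F x > m + k} \<le> exp (2 - D / 2 * k)"
proof -
  interpret prob_space M by fact
  interpret Q: prob_space Q
    unfolding Q_def by (intro prob_space_PiM prob)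
  have setsM: "sets M = sets borel" by (simp add: M_def)
  have spM: "space M = UNIV" by (simp add: M_def)
  have spQ: "space Q = extensional I"
    by (simp add: Q_def space_PiM spM PiE_def)
  have F' [measurable]: "F \<in> borel_measurable Q" by (simp add: Q_def F)
  have cube [measurable]: "cube \<in> sets Q"
    unfolding cube_def Q_def using I by (intro sets_PiM_I_finite) (auto simp: setsM)
  \<comment> \<open>With \<open>S\<close> the sum of the squares of
    \<open>D * (x i - y i) / 4\<close>, the slope \<open>l\<close> times the distance of
    \<open>x\<close> and \<open>y\<close> is \<open>2 * sqrt S\<close>, while the total cost is at
    least \<open>2 * (sqrt (1 + S) - 1)\<close>. The shift by -2 in \<open>v\<close> makes up the
    difference.\<close>
  define l where "l = D / 2"
  define u where "u = (\<lambda>x. ennreal (exp (- l * (F x - m))) * indicator cube x)"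
  define v where "v = (\<lambda>x. ennreal (exp (l * (F x - m) - 2)) * indicator cube x)"
  have cube_iff: "x \<in> cube \<longleftrightarrow> (\<forall>i\<in>I. x i \<in> {a..b})" if "x \<in> extensional I" for x
    using that by (auto simp: cube_def PiE_def)
  have upd: "x(i := s) \<in> extensional I" if "x \<in> extensional I" "i \<in> I" for x i and s :: real
    using that by (auto simp: extensional_def)
  have F_upd: "\<bar>F (x(i := s)) - F (x(i := t))\<bar> \<le> \<bar>s - t\<bar>"
    if "x \<in> extensional I" "i \<in> I" for x i s t
  proof -
    have "\<bar>F (x(i := s)) - F (x(i := t))\<bar> \<le> L2_set (\<lambda>j. (x(i := s)) j - (x(i := t)) j) I"
      by (intro lip upd that)
    also have "\<dots> \<le> (\<Sum>j\<in>I. \<bar>(x(i := s)) j - (x(i := t)) j\<bar>)"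
      by (rule L2_set_le_sum_abs)
    also have "\<dots> = (\<Sum>j\<in>I. if j = i then \<bar>s - t\<bar> else 0)"
      by (rule sum.cong) auto
    also have "\<dots> = \<bar>s - t\<bar>"
      using I that by simp
    finally show ?thesis .
  qed
  have cube_upd: "x(i := s) \<in> cube \<longleftrightarrow> x(i := t) \<in> cube"
    if "x \<in> extensional I" "i \<in> I" "s \<in> {a..b}" "t \<in> {a..b}" for x i s t
    using that by (auto simp: cube_iff upd)
  have l: "0 < l" using D by (simp add: l_def)
  have uv: "(\<integral>\<^sup>+x. u x \<partial>PiM I (\<lambda>_. M)) * (\<integral>\<^sup>+x. v x \<partial>PiM I (\<lambda>_. M)) \<le> ennreal 1"
  proof (rule nn_integral_PiM_mult_le[where S = "{a..b}" and L = l
        and c = "\<lambda>s t. 2 * (sqrt (1 + (D * (s - t) / 4)\<^sup>2) - 1)"])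
    show "sigma_finite_measure M" by unfold_locales
    show "sets M = sets borel" "finite I" "(0::real) < 1" by (auto simp: setsM I)
    show "u \<in> borel_measurable (PiM I (\<lambda>_. M))" "v \<in> borel_measurable (PiM I (\<lambda>_. M))"
      unfolding u_def v_def Q_def[symmetric] by measurable
    show "u x = 0" "v x = 0" if "x \<in> extensional I" "i \<in> I" "x i \<notin> {a..b}" for x i
    proof -
      have "x \<notin> cube"
        using that by (auto simp: cube_iff)
      then show "u x = 0" "v x = 0"
        by (simp_all add: u_def v_def)
    qed
    show "u (x(i := s)) \<le> ennreal (exp (l * \<bar>s - t\<bar>)) * u (x(i := t))"
      if "x \<in> extensional I" "i \<in> I" "s \<in> {a..b}" "t \<in> {a..b}" for x i s t
    proof -
      have "l * (F (x(i := t)) - F (x(i := s))) \<le> l * \<bar>s - t\<bar>"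
        using F_upd[OF that(1,2), of s t] l by (intro mult_left_mono) auto
      then have "- l * (F (x(i := s)) - m) \<le> l * \<bar>s - t\<bar> + - l * (F (x(i := t)) - m)"
        by (simp add: algebra_simps)
      then show ?thesis
        using cube_upd[OF that]
        by (simp add: u_def ennreal_leI indicator_def flip: ennreal_mult exp_add)
    qed
    show "v (x(i := s)) \<le> ennreal (exp (l * \<bar>s - t\<bar>)) * v (x(i := t))"
      if "x \<in> extensional I" "i \<in> I" "s \<in> {a..b}" "t \<in> {a..b}" for x i s t
    proof -
      have "l * (F (x(i := s)) - F (x(i := t))) \<le> l * \<bar>s - t\<bar>"
        using F_upd[OF that(1,2), of s t] l by (intro mult_left_mono) auto
      then have "l * (F (x(i := s)) - m) - 2 \<le> l * \<bar>s - t\<bar> + (l * (F (x(i := t)) - m) - 2)"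
        by (simp add: algebra_simps)
      then show ?thesis
        using cube_upd[OF that]
        by (simp add: v_def ennreal_leI indicator_def flip: ennreal_mult exp_add)
    qed
    show "u x * v y \<le> ennreal (1 * exp (\<Sum>i\<in>I. 2 * (sqrt (1 + (D * (x i - y i) / 4)\<^sup>2) - 1)))"
      if "x \<in> Pi\<^sub>E I (\<lambda>_. {a..b})" "y \<in> Pi\<^sub>E I (\<lambda>_. {a..b})" for x y
    proof -
      have xy: "x \<in> extensional I" "y \<in> extensional I" "x \<in> cube" "y \<in> cube"
        using that by (auto simp: PiE_def cube_def)
      define S where "S = (\<Sum>i\<in>I. (D * (x i - y i) / 4)\<^sup>2)"
      have "l * (F y - F x) \<le> l * L2_set (\<lambda>i. x i - y i) I"
        using lip[OF xy(1,2)] l by (intro mult_left_mono) auto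
      also have "\<dots> = 2 * sqrt S"
      proof -
        have "S = (D / 4)\<^sup>2 * (\<Sum>i\<in>I. (x i - y i)\<^sup>2)"
          by (simp add: S_def sum_distrib_left power_divide power_mult_distrib)
        then have "sqrt S = D / 4 * L2_set (\<lambda>i. x i - y i) I"
          using D by (simp add: L2_set_def real_sqrt_mult)
        then show ?thesis by (simp add: l_def)
      qed
      finally have "l * (F y - F x) \<le> 2 * sqrt S" .
      moreover have "sqrt S \<le> sqrt (1 + S)" by simp
      moreover have "sqrt (1 + S) - 1 \<le> (\<Sum>i\<in>I. sqrt (1 + (D * (x i - y i) / 4)\<^sup>2) - 1)"
        unfolding S_def by (intro sqrt_sum_le I) auto
      ultimately have "- l * (F x - m) + (l * (F y - m) - 2) \<le>
          2 * (\<Sum>i\<in>I. sqrt (1 + (D * (x i - y i) / 4)\<^sup>2) - 1)"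
        unfolding right_diff_distrib by linarith
      then have "- l * (F x - m) + (l * (F y - m) - 2) \<le>
          (\<Sum>i\<in>I. 2 * (sqrt (1 + (D * (x i - y i) / 4)\<^sup>2) - 1))"
        by (simp only: sum_distrib_left)
      then show ?thesis
        using xy by (simp add: u_def v_def ennreal_leI flip: ennreal_mult exp_add)
    qed
    show "(\<integral>\<^sup>+s. u s \<partial>M) * (\<integral>\<^sup>+s. v s \<partial>M) \<le> ennreal K"
      if "u \<in> borel_measurable borel" "v \<in> borel_measurable borel"
        "\<And>s. s \<notin> {a..b} \<Longrightarrow> u s = 0" "\<And>s. s \<notin> {a..b} \<Longrightarrow> v s = 0"
        "\<And>s t. s \<in> {a..b} \<Longrightarrow> t \<in> {a..b} \<Longrightarrow> u s \<le> ennreal (exp (l * \<bar>s - t\<bar>)) * u t"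
        "\<And>s t. s \<in> {a..b} \<Longrightarrow> t \<in> {a..b} \<Longrightarrow> v s \<le> ennreal (exp (l * \<bar>s - t\<bar>)) * v t"
        "0 < K"
        "\<And>s t. s \<in> {a..b} \<Longrightarrow> t \<in> {a..b} \<Longrightarrow>
          u s * v t \<le> ennreal (K * exp (2 * (sqrt (1 + (D * (s - t) / 4)\<^sup>2) - 1)))"
      for u v K
      unfolding M_def
      by (rule nn_integral_mult_nn_integral_le[OF ab D less_imp_le[OF l] that(7) meas that(1,2) eq pos
            cont mass cheeger that(3,4) that(5,6) that(8)])
  qed
  define A where "A = {x \<in> cube. F x \<le> m}"
  define B where "B = {x \<in> cube. F x > m + k}"
  have cubeE: "cube \<subseteq> space Q" using sets.sets_into_space[OF cube] .
  have AB [measurable]: "A \<in> sets Q" "B \<in> sets Q"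
  proof -
    have "A = cube \<inter> {x \<in> space Q. F x \<le> m}" "B = cube \<inter> {x \<in> space Q. F x > m + k}"
      using cubeE by (auto simp: A_def B_def)
    then show "A \<in> sets Q" "B \<in> sets Q" by auto
  qed
  have "emeasure Q A = (\<integral>\<^sup>+x. indicator A x \<partial>Q)"
    by simp
  also have "\<dots> \<le> (\<integral>\<^sup>+x. u x \<partial>Q)"
    using l by (intro nn_integral_mono) (auto simp: u_def A_def indicator_def mult_le_0_iff)
  finally have A: "emeasure Q A \<le> (\<integral>\<^sup>+x. u x \<partial>Q)" .
  have "ennreal (exp (l * k - 2)) * emeasure Q B = (\<integral>\<^sup>+x. ennreal (exp (l * k - 2)) * indicator B x \<partial>Q)"
    by (simp add: nn_integral_cmult)
  also have "\<dots> \<le> (\<integral>\<^sup>+x. v x \<partial>Q)"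
  proof (intro nn_integral_mono)
    fix x
    show "ennreal (exp (l * k - 2)) * indicator B x \<le> v x"
    proof (cases "x \<in> B")
      case True
      then have "l * k \<le> l * (F x - m)"
        using l by (intro mult_left_mono) (auto simp: B_def)
      with True show ?thesis
        by (auto simp: B_def v_def intro!: ennreal_leI)
    qed simp
  qed
  finally have B: "ennreal (exp (l * k - 2)) * emeasure Q B \<le> (\<integral>\<^sup>+x. v x \<partial>Q)" .
  have "emeasure Q A * (ennreal (exp (l * k - 2)) * emeasure Q B) \<le> ennreal 1"
    using mult_mono[OF A B] uv by (auto simp: Q_def intro: order_trans)
  then have "measure Q A * (exp (l * k - 2) * measure Q B) \<le> 1"
    by (simp add: Q.emeasure_eq_measure ennreal_le_iff flip: ennreal_mult ennreal_1)
  then have "measure Q A * measure Q B \<le> 1 / exp (l * k - 2)"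
    by (simp add: field_simps)
  also have "\<dots> = exp (2 - l * k)"
    by (simp add: exp_diff)
  finally show ?thesis
    by (simp add: A_def B_def l_def)
qed

subsection \<open>Concave potentials\<close>

text \<open>Integrability of the density and differentiability at the truncation radius
  \<open>R\<close> are explicit assumptions of the lemmas here; the locale
  \<open>regular_concave_potential\<close> later supplies both.\<close>

locale concave_potential =
  fixes \<Phi> :: "real \<Rightarrow> real"
  assumes Phi_mono: "strict_mono_on {0..} \<Phi>"
    and Phi_concave: "concave_on {0..} \<Phi>"
    and Phi_zero: "\<Phi> 0 = 0"
begin

lemma Phi_le: "0 \<le> x \<Longrightarrow> x \<le> y \<Longrightarrow> \<Phi> x \<le> \<Phi> y"
  using strict_mono_on_leD[OF Phi_mono, of x y] by auto

lemma Phi_less: "0 \<le> x \<Longrightarrow> x < y \<Longrightarrow> \<Phi> x < \<Phi> y"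
  using strict_mono_onD[OF Phi_mono, of x y] by auto

lemma Phi_nonneg: "0 \<le> x \<Longrightarrow> 0 \<le> \<Phi> x"
  using Phi_le[of 0 x] by (simp add: Phi_zero)

lemma Phi_pos: "0 < x \<Longrightarrow> 0 < \<Phi> x"
  using Phi_less[of 0 x] by (simp add: Phi_zero)

lemma measurable_Phi_abs [measurable]: "(\<lambda>x. \<Phi> \<bar>x\<bar>) \<in> borel_measurable borel"
proof -
  have "mono (\<lambda>x. \<Phi> (max 0 x))"
    by (intro monoI Phi_le) auto
  from borel_measurable_mono[OF this]
  have "(\<lambda>x. \<Phi> (max 0 \<bar>x\<bar>)) \<in> borel_measurable borel"
    by (rule measurable_compose[rotated]) simp
  then show ?thesis by simp
qed

lemma continuous_on_Phi: "continuous_on {0<..} \<Phi>"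
proof -
  have "convex_on {0<..} (\<lambda>x. - \<Phi> x)"
    using Phi_concave unfolding concave_on_def by (rule convex_on_subset) auto
  then have "continuous_on {0<..} (\<lambda>x. - \<Phi> x)"
    by (intro convex_on_continuous) auto
  from continuous_on_minus[OF this] show ?thesis by simp
qed

text \<open>The endpoint \<open>y = 0\<close> is included: it yields
  \<open>x * deriv \<Phi> x \<le> \<Phi> x\<close>. Taking \<open>y = 2 * x\<close> yields, with the
  doubling condition, a reverse comparison.\<close>

lemma below_tangent:
  assumes "0 < x" "\<Phi> differentiable at x" "0 \<le> y"
  shows "\<Phi> y - \<Phi> x \<le> deriv \<Phi> x * (y - x)"
proof -
  have "(\<Phi> has_real_derivative deriv \<Phi> x) (at x)"
    using assms(2) by (simp add: DERIV_deriv_iff_real_differentiable)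
  then have "((\<lambda>x. - \<Phi> x) has_real_derivative - deriv \<Phi> x) (at x within {0..})"
    by (rule DERIV_minus[OF has_field_derivative_at_within])
  moreover have "x \<in> interior {0..}"
    using assms(1) by (simp add: interior_real_atLeast)
  moreover have "convex_on {0..} (\<lambda>x. - \<Phi> x)"
    using Phi_concave by (simp add: concave_on_def)
  ultimately have "- deriv \<Phi> x * (y - x) \<le> - \<Phi> y - - \<Phi> x"
    using assms(3) by (intro convex_on_imp_above_tangent[OF _ connected_Ici]) simp_all
  then show ?thesis by simp
qed

lemma deriv_mult_le:
  assumes "0 < x" "\<Phi> differentiable at x"
  shows "x * deriv \<Phi> x \<le> \<Phi> x"
  using below_tangent[OF assms, of 0] by (simp add: Phi_zero mult.commute)

text \<open>Chord slopes of a concave function decrease to the right: the slope over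
  \<open>r\<close>, \<open>x\<close> is at least that over \<open>x\<close>, \<open>R\<close>, which
  is at least the tangent slope at \<open>R\<close>.\<close>

lemma increment_ge:
  assumes R: "0 < R" "\<Phi> differentiable at R" and "0 \<le> r" "r \<le> x" "x \<le> R"
  shows "deriv \<Phi> R * (x - r) \<le> \<Phi> x - \<Phi> r"
proof (cases "r < x \<and> x < R")
  case True
  have tangent: "deriv \<Phi> R * (R - x) \<le> \<Phi> R - \<Phi> x"
    using below_tangent[OF R, of x] True assms by (simp add: algebra_simps)
  have "(- \<Phi> r - - \<Phi> R) / (r - R) \<le> (- \<Phi> x - - \<Phi> R) / (x - R)"
    "(- \<Phi> r - - \<Phi> x) / (r - x) \<le> (- \<Phi> r - - \<Phi> R) / (r - R)"
    using convex_on_slope_le[of "{0..}" "\<lambda>x. - \<Phi> x" r R x] Phi_concave True assms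
    by (auto simp: concave_on_def)
  then have "(- \<Phi> r - - \<Phi> x) / (r - x) \<le> (- \<Phi> x - - \<Phi> R) / (x - R)"
    by linarith
  moreover have "(- \<Phi> r - - \<Phi> x) / (r - x) = - ((\<Phi> x - \<Phi> r) / (x - r))"
    "(- \<Phi> x - - \<Phi> R) / (x - R) = - ((\<Phi> R - \<Phi> x) / (R - x))"
    using True by (auto simp: field_simps)
  moreover have "deriv \<Phi> R \<le> (\<Phi> R - \<Phi> x) / (R - x)"
    using tangent True by (simp add: field_simps)
  ultimately have "deriv \<Phi> R \<le> (\<Phi> x - \<Phi> r) / (x - r)"
    by linarith
  then show ?thesis
    using True by (simp add: field_simps)
next
  case False
  then consider "r = x" | "x = R" using assms by linarith
  then show ?thesis
  proof cases
    case 2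
    then show ?thesis
      using below_tangent[OF R, of r] assms by (simp add: algebra_simps)
  qed simp
qed

text \<open>
  A concave function may jump at the endpoint \<open>0\<close> of its domain, so \<open>\<Phi> \<bar>x\<bar>\<close> is replaced
  by its continuous modification, which differs from it at most at \<open>0\<close>.
\<close>

definition Phi_cont :: "real \<Rightarrow> real" where
  "Phi_cont x = (if x = 0 then Inf (\<Phi> ` {0<..}) else \<Phi> \<bar>x\<bar>)"

lemma bdd_below_Phi: "bdd_below (\<Phi> ` {0<..})"
  by (rule bdd_belowI[of _ 0]) (auto intro: Phi_nonneg)

lemma continuous_on_Phi_cont: "continuous_on UNIV Phi_cont"
proof -
  define J where "J = Inf (\<Phi> ` {0<..})"
  have J_le: "J \<le> \<Phi> x" if "0 < x" for x
    unfolding J_def using that by (intro cInf_lower bdd_below_Phi) auto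
  have "isCont Phi_cont x" for x
  proof (cases "x = 0")
    case False
    have "isCont \<Phi> \<bar>x\<bar>"
      using continuous_on_Phi False by (subst (asm) continuous_on_eq_continuous_at) auto
    then have "isCont (\<lambda>x. \<Phi> \<bar>x\<bar>) x"
      by (rule isCont_o2[rotated]) simp
    moreover have "\<forall>\<^sub>F y in nhds x. Phi_cont y = \<Phi> \<bar>y\<bar>"
      using t1_space_nhds[OF False] by eventually_elim (simp add: Phi_cont_def)
    ultimately show ?thesis
      by (subst isCont_cong) auto
  next
    case True
    have "(Phi_cont \<longlongrightarrow> J) (at 0)"
    proof (rule order_tendstoI)
      fix c assume "c < J"
      then have "c < Phi_cont y" for y
        using J_le[of "\<bar>y\<bar>"] by (cases "y = 0") (simp_all add: Phi_cont_def J_def)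
      then show "\<forall>\<^sub>F y in at 0. c < Phi_cont y"
        by simp
    next
      fix c assume "J < c"
      then obtain x where x: "0 < x" "\<Phi> x < c"
        using cInf_lessD[of "\<Phi> ` {0<..}" c] by (auto simp: J_def)
      show "\<forall>\<^sub>F y in at 0. Phi_cont y < c"
        unfolding eventually_at
      proof (intro exI[of _ x] conjI ballI impI)
        fix y :: real assume "y \<noteq> 0 \<and> dist y 0 < x"
        then show "Phi_cont y < c"
          using Phi_le[of "\<bar>y\<bar>" x] x by (auto simp: Phi_cont_def dist_real_def)
      qed (use x in auto)
    qed
    then show ?thesis
      using True by (simp add: isCont_def Phi_cont_def[of 0] J_def)
  qed
  then show ?thesis
    by (simp add: continuous_on_eq_continuous_at)
qed

lemma Phi_cont_increment_ge:
  assumes R: "0 < R" "\<Phi> differentiable at R" "0 < deriv \<Phi> R"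
    and "0 \<le> r" "r \<le> x" "x \<le> R"
  shows "deriv \<Phi> R * (x - r) \<le> Phi_cont x - Phi_cont r"
proof (cases "r = 0 \<and> 0 < x")
  case True
  have "Inf (\<Phi> ` {0<..}) \<le> \<Phi> x - deriv \<Phi> R * x"
  proof (rule field_le_epsilon)
    fix e :: real assume e: "0 < e"
    \<comment> \<open>A point close enough to 0 to approximate the infimum: replacing
      \<open>x - s\<close> by \<open>x\<close> in the linear bound costs
      \<open>deriv \<Phi> R * s\<close>, which is at most \<open>e\<close>.\<close>
    define s where "s = min x (e / deriv \<Phi> R)"
    have s: "0 < s" "s \<le> x" "s \<le> e / deriv \<Phi> R"
      using True e R by (auto simp: s_def)
    have "Inf (\<Phi> ` {0<..}) \<le> \<Phi> s"
      using s by (intro cInf_lower bdd_below_Phi) auto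
    also have "\<dots> \<le> \<Phi> x - deriv \<Phi> R * (x - s)"
      using increment_ge[OF R(1,2), of s x] s assms by simp
    also have "\<dots> \<le> \<Phi> x - deriv \<Phi> R * x + e"
      using s R by (simp add: field_simps)
    finally show "Inf (\<Phi> ` {0<..}) \<le> \<Phi> x - deriv \<Phi> R * x + e" .
  qed
  then show ?thesis
    using True by (simp add: Phi_cont_def)
next
  case False
  then show ?thesis
    using increment_ge[OF R(1,2), of r x] assms by (auto simp: Phi_cont_def)
qed

text \<open>From \<open>x\<close> to \<open>R\<close> the potential grows at least linearly with
  slope \<open>deriv \<Phi> R\<close>, so the density lies below an exponential whose integral is
  explicit.\<close>

lemma integral_exp_Phi_cont_le:
  assumes R: "0 < R" "\<Phi> differentiable at R" "0 < deriv \<Phi> R" and x: "0 \<le> x" "x \<le> R"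
  shows "deriv \<Phi> R * integral {x..R} (\<lambda>t. exp (- Phi_cont t)) \<le> exp (- Phi_cont x)"
proof -
  define D where "D = deriv \<Phi> R"
  have D: "0 < D" using R by (simp add: D_def)
  have ub: "((\<lambda>t. exp (- Phi_cont x - D * (t - x))) has_integral
      (- exp (- Phi_cont x - D * (R - x)) / D - - exp (- Phi_cont x - D * (x - x)) / D)) {x..R}"
    by (rule fundamental_theorem_of_calculus[OF x(2)])
      (use D in \<open>auto intro!: derivative_eq_intros simp flip: has_real_derivative_iff_has_vector_derivative\<close>)
  have "(\<lambda>t. exp (- Phi_cont t)) integrable_on {x..R}"
    by (intro integrable_continuous_real continuous_intros continuous_on_subset[OF continuous_on_Phi_cont]) auto
  then have "((\<lambda>t. exp (- Phi_cont t)) has_integral integral {x..R} (\<lambda>t. exp (- Phi_cont t))) {x..R}"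
    by (rule integrable_integral)
  moreover note ub
  moreover have "exp (- Phi_cont t) \<le> exp (- Phi_cont x - D * (t - x))" if "t \<in> {x..R}" for t
    using Phi_cont_increment_ge[OF R, of x t] that x by (simp add: D_def)
  ultimately have "integral {x..R} (\<lambda>t. exp (- Phi_cont t)) \<le>
      - exp (- Phi_cont x - D * (R - x)) / D - - exp (- Phi_cont x - D * (x - x)) / D"
    by (rule has_integral_le)
  also have "\<dots> \<le> exp (- Phi_cont x) / D"
    using D by (simp add: field_simps)
  finally show ?thesis
    using D by (simp add: D_def field_simps)
qed

text \<open>For \<open>0 \<le> x\<close> the right-hand mass is controlled directly; for negative
  \<open>x\<close> reflection transfers this to the left-hand mass.\<close>

lemma cheeger:
  assumes R: "0 < R" "\<Phi> differentiable at R" "0 < deriv \<Phi> R" and x: "x \<in> {-R<..<R}"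
  shows "deriv \<Phi> R * integral {-R..x} (\<lambda>t. exp (- Phi_cont t)) \<le> exp (- Phi_cont x) \<or>
    deriv \<Phi> R * integral {x..R} (\<lambda>t. exp (- Phi_cont t)) \<le> exp (- Phi_cont x)"
proof (cases "0 \<le> x")
  case True
  then show ?thesis
    using integral_exp_Phi_cont_le[OF R, of x] x by auto
next
  case False
  have even: "Phi_cont (- t) = Phi_cont t" for t
    by (simp add: Phi_cont_def)
  have "integral {-R..x} (\<lambda>t. exp (- Phi_cont t)) = integral {-x..R} (\<lambda>t. exp (- Phi_cont t))"
    using Henstock_Kurzweil_Integration.integral_reflect_real[of R "-x" "\<lambda>t. exp (- Phi_cont t)"] by (simp add: even)
  then show ?thesis
    using integral_exp_Phi_cont_le[OF R, of "-x"] x False by (auto simp: even)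
qed

section \<open>The probability measure of the potential, its tails, and concentration of its powers
  around a median\<close>

lemma Z_Phi_pos:
  assumes int: "integrable lborel (\<lambda>x. exp (- \<Phi> \<bar>x\<bar>))"
  shows "0 < Z_Phi \<Phi>"
proof -
  have "integrable lborel (\<lambda>x. exp (- \<Phi> 1) * indicator {0..1::real} x)"
    by (intro integrable_mult_right integrable_real_indicator) auto
  moreover have "exp (- \<Phi> 1) * indicator {0..1} x \<le> exp (- \<Phi> \<bar>x\<bar>)" for x :: real
    using Phi_le[of x 1] by (auto simp: indicator_def)
  ultimately have "(LINT x|lborel. exp (- \<Phi> 1) * indicator {0..1::real} x) \<le> (LINT x|lborel. exp (- \<Phi> \<bar>x\<bar>))"
    using int by (intro integral_mono)
  moreover have "(LINT x|lborel. exp (- \<Phi> 1) * indicator {0..1::real} x) = exp (- \<Phi> 1)"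
    by simp
  ultimately show ?thesis
    using exp_gt_zero[of "- \<Phi> 1"] unfolding Z_Phi_def by linarith
qed

lemma prob_space_mu_Phi:
  assumes int: "integrable lborel (\<lambda>x. exp (- \<Phi> \<bar>x\<bar>))"
  shows "prob_space (mu_Phi \<Phi>)"
proof (rule prob_spaceI)
  have "emeasure (mu_Phi \<Phi>) (space (mu_Phi \<Phi>)) = (\<integral>\<^sup>+x. ennreal (exp (- \<Phi> \<bar>x\<bar>) / Z_Phi \<Phi>) \<partial>lborel)"
    by (simp add: mu_Phi_def emeasure_density)
  also have "\<dots> = ennreal (LINT x|lborel. exp (- \<Phi> \<bar>x\<bar>) / Z_Phi \<Phi>)"
    using int Z_Phi_pos[OF int] by (intro nn_integral_eq_integral) auto
  also have "(LINT x|lborel. exp (- \<Phi> \<bar>x\<bar>) / Z_Phi \<Phi>) = 1"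
    using Z_Phi_pos[OF int] by (simp add: Z_Phi_def)
  finally show "emeasure (mu_Phi \<Phi>) (space (mu_Phi \<Phi>)) = 1"
    by simp
qed

lemma sets_mu_Phi [simp]: "sets (mu_Phi \<Phi>) = sets borel"
  by (simp add: mu_Phi_def)

lemma mu_Phi_cube_concentration:
  assumes int: "integrable lborel (\<lambda>x. exp (- \<Phi> \<bar>x\<bar>))"
    and R: "0 < R" "\<Phi> differentiable at R" "0 < deriv \<Phi> R"
    and F: "one_Lipschitz n F"
  defines "cube \<equiv> {..<n} \<rightarrow>\<^sub>E {-R..R}"
  shows "measure (mu_Phi_n \<Phi> n) {x \<in> cube. F x \<le> m} * measure (mu_Phi_n \<Phi> n) {x \<in> cube. F x > m + k}
    \<le> exp (2 - deriv \<Phi> R / 2 * k)"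
proof -
  note Z = Z_Phi_pos[OF int]
  note prob = prob_space_mu_Phi[OF int]
  interpret prob_space "mu_Phi \<Phi>" by (rule prob)
  define \<rho> where "\<rho> = (\<lambda>x. exp (- \<Phi> \<bar>x\<bar>) / Z_Phi \<Phi>)"
  define \<rho>' where "\<rho>' = (\<lambda>x. exp (- Phi_cont x) / Z_Phi \<Phi>)"
  have mu: "mu_Phi \<Phi> = density lborel (\<lambda>x. ennreal (\<rho> x))"
    by (simp add: mu_Phi_def \<rho>_def)
  have meas: "\<rho> \<in> borel_measurable borel"
    unfolding \<rho>_def by measurable
  have eq: "\<rho> x = \<rho>' x" if "x \<in> {-R..R}" "x \<noteq> 0" for x
    using that by (simp add: \<rho>_def \<rho>'_def Phi_cont_def)
  have pos: "0 < \<rho>' x" for x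
    using Z by (simp add: \<rho>'_def)
  have cont: "continuous_on {-R..R} \<rho>'"
    unfolding \<rho>'_def using Z
    by (intro continuous_intros continuous_on_subset[OF continuous_on_Phi_cont]) auto
  have lip: "\<bar>F x - F y\<bar> \<le> L2_set (\<lambda>i. x i - y i) {..<n}"
    if "x \<in> extensional {..<n}" "y \<in> extensional {..<n}" for x y
    using F that by (auto simp: one_Lipschitz_def PiE_def)
  \<comment> \<open>The restriction to the interval is not renormalised; as part of a probability
    measure it has mass at most 1.\<close>
  have mass: "integral {-R..R} \<rho>' \<le> 1"
  proof -
    have "(\<integral>\<^sup>+x. indicator {-R..R} x \<partial>density lborel (\<lambda>x. ennreal (\<rho> x))) =
        ennreal (integral {-R..R} (\<lambda>x. 1 * \<rho>' x))"
      by (rule nn_integral_density_continuous[OF meas _ eq less_imp_le[OF pos] zero_le_one cont])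
        auto
    then have "ennreal (integral {-R..R} \<rho>') = emeasure (mu_Phi \<Phi>) {-R..R}"
      by (simp add: mu)
    also have "\<dots> \<le> 1"
      by (rule emeasure_le_1)
    finally show ?thesis
      by (simp add: ennreal_le_1)
  qed
  have scale: "integral S \<rho>' = integral S (\<lambda>t. exp (- Phi_cont t)) / Z_Phi \<Phi>" for S
    by (simp add: \<rho>'_def)
  have iso: "deriv \<Phi> R * integral {-R..x} \<rho>' \<le> \<rho>' x \<or> deriv \<Phi> R * integral {x..R} \<rho>' \<le> \<rho>' x"
    if "x \<in> {-R<..<R}" for x
    using cheeger[OF R that] Z by (auto simp: scale \<rho>'_def divide_right_mono)
  show ?thesis
    unfolding cube_def mu_Phi_n_def using R(1)
    by (intro cube_concentration[OF _ _ R(3) meas mu prob eq pos cont mass iso _ lip]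
        measurable_Lipschitz_PiM[OF _ sets_mu_Phi lip]) auto
qed

text \<open>Outside the interval three quarters of the exponent are bounded by their value at
  \<open>R\<close>, and the remaining quarter is integrated. With the rate 3/4, a decay
  \<open>exp (- \<Phi> R / 4)\<close> is left after a dimension factor of at most
  \<open>exp (\<Phi> R / 2)\<close>.\<close>

lemma mu_Phi_tail:
  assumes int: "integrable lborel (\<lambda>x. exp (- \<Phi> \<bar>x\<bar>))"
    and int4: "integrable lborel (\<lambda>x. exp (- \<Phi> \<bar>x\<bar> / 4))"
    and R: "0 \<le> R"
  shows "measure (mu_Phi \<Phi>) (UNIV - {-R..R}) \<le>
    (LINT x|lborel. exp (- \<Phi> \<bar>x\<bar> / 4)) / Z_Phi \<Phi> * exp (- (3 / 4) * \<Phi> R)"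
proof -
  note Z = Z_Phi_pos[OF int]
  interpret prob_space "mu_Phi \<Phi>" by (rule prob_space_mu_Phi[OF int])
  define g where "g = (\<lambda>x. exp (- (3 / 4) * \<Phi> R) * (exp (- \<Phi> \<bar>x\<bar> / 4) / Z_Phi \<Phi>))"
  have g_int: "integrable lborel g"
    unfolding g_def using int4 by simp
  have "emeasure (mu_Phi \<Phi>) (UNIV - {-R..R}) =
      (\<integral>\<^sup>+x. ennreal (exp (- \<Phi> \<bar>x\<bar>) / Z_Phi \<Phi>) * indicator (UNIV - {-R..R}) x \<partial>lborel)"
    by (simp add: mu_Phi_def emeasure_density)
  also have "\<dots> \<le> (\<integral>\<^sup>+x. ennreal (g x) \<partial>lborel)"
  proof (rule nn_integral_mono)
    fix x :: real
    show "ennreal (exp (- \<Phi> \<bar>x\<bar>) / Z_Phi \<Phi>) * indicator (UNIV - {-R..R}) x \<le> ennreal (g x)"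
    proof (cases "x \<in> {-R..R}")
      case False
      then have "\<Phi> R \<le> \<Phi> \<bar>x\<bar>"
        using R by (intro Phi_le) auto
      then have "exp (- \<Phi> \<bar>x\<bar>) \<le> exp (- (3 / 4) * \<Phi> R + - \<Phi> \<bar>x\<bar> / 4)"
        by simp
      then have "exp (- \<Phi> \<bar>x\<bar>) / Z_Phi \<Phi> \<le> g x"
        using Z by (simp only: g_def exp_add times_divide_eq_right) (simp add: divide_right_mono)
      then show ?thesis
        using False by (simp add: ennreal_leI)
    qed simp
  qed
  also have "\<dots> = ennreal (LINT x|lborel. g x)"
    using g_int Z by (intro nn_integral_eq_integral) (auto simp: g_def)
  finally have "measure (mu_Phi \<Phi>) (UNIV - {-R..R}) \<le> (LINT x|lborel. g x)"
    using Z by (simp add: emeasure_eq_measure ennreal_le_iff g_def)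
  then show ?thesis
    by (simp add: g_def mult.commute)
qed

text \<open>The cube has probability \<open>(1 - p) ^ n\<close>, with \<open>p\<close> the mass
  outside the interval; Bernoulli's inequality then gives the union bound over the
  coordinates.\<close>

lemma mu_Phi_n_outside_cube:
  fixes n :: nat and R :: real
  assumes int: "integrable lborel (\<lambda>x. exp (- \<Phi> \<bar>x\<bar>))"
  defines "cube \<equiv> {..<n} \<rightarrow>\<^sub>E {-R..R}"
  shows "cube \<in> sets (mu_Phi_n \<Phi> n)"
    and "measure (mu_Phi_n \<Phi> n) (space (mu_Phi_n \<Phi> n) - cube) \<le>
      real n * measure (mu_Phi \<Phi>) (UNIV - {-R..R})"
proof -
  note prob = prob_space_mu_Phi[OF int]
  interpret prob_space "mu_Phi \<Phi>" by (rule prob)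
  interpret Q: prob_space "mu_Phi_n \<Phi> n"
    unfolding mu_Phi_n_def by (intro prob_space_PiM prob)
  interpret product_sigma_finite "\<lambda>_::nat. mu_Phi \<Phi>"
    by (simp add: product_sigma_finite_def sigma_finite_measure_axioms)
  have sp: "space (mu_Phi \<Phi>) = UNIV" by (simp add: mu_Phi_def)
  show cube: "cube \<in> sets (mu_Phi_n \<Phi> n)"
    unfolding cube_def mu_Phi_n_def by (intro sets_PiM_I_finite) auto
  define p where "p = measure (mu_Phi \<Phi>) (UNIV - {-R..R})"
  have p1: "measure (mu_Phi \<Phi>) {-R..R} = 1 - p"
    using prob_compl[of "{-R..R}"] by (simp add: p_def sp)
  have "emeasure (mu_Phi_n \<Phi> n) (cube) = (\<Prod>i<n. emeasure (mu_Phi \<Phi>) {-R..R})"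
    unfolding cube_def mu_Phi_n_def by (intro emeasure_PiM) auto
  then have "measure (mu_Phi_n \<Phi> n) (cube) = (1 - p) ^ n"
    by (simp add: emeasure_eq_measure Q.emeasure_eq_measure ennreal_power p1 flip: p1)
  moreover have "1 + real n * - p \<le> (1 + - p) ^ n"
    by (intro Bernoulli_inequality) (simp add: p_def)
  ultimately show "measure (mu_Phi_n \<Phi> n) (space (mu_Phi_n \<Phi> n) - cube) \<le>
      real n * measure (mu_Phi \<Phi>) (UNIV - {-R..R})"
    using Q.prob_compl[OF cube] by (simp add: p_def)
qed

lemma median_concentration:
  assumes int: "integrable lborel (\<lambda>x. exp (- \<Phi> \<bar>x\<bar>))"
    and int4: "integrable lborel (\<lambda>x. exp (- \<Phi> \<bar>x\<bar> / 4))"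
    and R: "0 < R" "\<Phi> differentiable at R" "0 < deriv \<Phi> R"
    and F: "one_Lipschitz n F" and m: "is_median (mu_Phi_n \<Phi> n) F m"
  defines "C \<equiv> (LINT x|lborel. exp (- \<Phi> \<bar>x\<bar> / 4)) / Z_Phi \<Phi>"
  shows "measure (mu_Phi_n \<Phi> n) {x \<in> space (mu_Phi_n \<Phi> n). \<bar>F x - m\<bar> > k}
    \<le> 4 * real n * C * exp (- (3 / 4) * \<Phi> R) + 8 * exp (2 - deriv \<Phi> R / 2 * k)"
proof -
  note prob = prob_space_mu_Phi[OF int]
  interpret Q: prob_space "mu_Phi_n \<Phi> n"
    unfolding mu_Phi_n_def by (intro prob_space_PiM prob)
  define Q where "Q = mu_Phi_n \<Phi> n"
  define cube where "cube = ({..<n} \<rightarrow>\<^sub>E {-R..R})"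
  define \<delta> where "\<delta> = measure Q (space Q - cube)"
  note [measurable] = mu_Phi_n_outside_cube(1)[OF int, of n R, folded cube_def]
  have lip: "\<bar>F x - F y\<bar> \<le> L2_set (\<lambda>i. x i - y i) {..<n}"
    if "x \<in> extensional {..<n}" "y \<in> extensional {..<n}" for x y
    using F that by (auto simp: one_Lipschitz_def PiE_def)
  have [measurable]: "F \<in> borel_measurable (mu_Phi_n \<Phi> n)"
    unfolding mu_Phi_n_def by (intro measurable_Lipschitz_PiM lip) auto
  have sub: "cube \<subseteq> space Q"
    by (auto simp: cube_def Q_def space_mu_Phi_n)
  have \<delta>_le: "\<delta> \<le> real n * C * exp (- (3 / 4) * \<Phi> R)"
  proof -
    have "\<delta> \<le> real n * measure (mu_Phi \<Phi>) (UNIV - {-R..R})"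
      using mu_Phi_n_outside_cube(2)[OF int, of n R] by (simp add: \<delta>_def Q_def cube_def)
    also have "\<dots> \<le> real n * (C * exp (- (3 / 4) * \<Phi> R))"
      unfolding C_def using R by (intro mult_left_mono mu_Phi_tail int int4) auto
    finally show ?thesis by (simp add: mult.assoc)
  qed
  have "measure Q {x \<in> space Q. \<bar>F x - m\<bar> > k} \<le> 4 * \<delta> + 8 * exp (2 - deriv \<Phi> R / 2 * k)"
  \<comment> \<open>If the cube misses at least a quarter of the mass, \<open>4 * \<delta>\<close>
    already exceeds every probability.\<close>
  proof (cases "1 / 4 \<le> \<delta>")
    case True
    have "measure Q {x \<in> space Q. \<bar>F x - m\<bar> > k} \<le> 1"
      unfolding Q_def by (rule Q.prob_le_1)
    also have "1 \<le> 4 * \<delta> + 8 * exp (2 - deriv \<Phi> R / 2 * k)"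
      using True by (intro add_increasing2) auto
    finally show ?thesis .
  next
    case False
    \<comment> \<open>Passing to the cube costs the half-mass event less than 1/4, so at least 1/4
      remains as the first factor of the product estimate; hence the constant 4. Using it for
      \<open>F\<close> and for its negative gives the 8.\<close>
    have one_sided: "measure Q {x \<in> cube. F' x > m' + k} \<le> 4 * exp (2 - deriv \<Phi> R / 2 * k)"
      if F': "one_Lipschitz n F'" and meas: "F' \<in> borel_measurable (mu_Phi_n \<Phi> n)"
        and half: "1 / 2 \<le> measure Q {x \<in> space Q. F' x \<le> m'}" for F' m'
    proof -
      note [measurable] = meas
      have "{x \<in> cube. F' x \<le> m'} = cube \<inter> {x \<in> space Q. F' x \<le> m'}"
        using sub by auto
      then have A: "{x \<in> cube. F' x \<le> m'} \<in> sets Q"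
        by (simp add: Q_def)
      have "measure Q {x \<in> space Q. F' x \<le> m'} \<le> measure Q ({x \<in> cube. F' x \<le> m'} \<union> (space Q - cube))"
        using A unfolding Q_def by (intro Q.finite_measure_mono) auto
      also have "\<dots> \<le> measure Q {x \<in> cube. F' x \<le> m'} + \<delta>"
        using A unfolding Q_def \<delta>_def by (intro measure_Un_le) auto
      finally have "1 / 4 \<le> measure Q {x \<in> cube. F' x \<le> m'}"
        using half False by linarith
      then have "1 / 4 * measure Q {x \<in> cube. F' x > m' + k} \<le>
          measure Q {x \<in> cube. F' x \<le> m'} * measure Q {x \<in> cube. F' x > m' + k}"
        by (intro mult_right_mono) auto
      also have "\<dots> \<le> exp (2 - deriv \<Phi> R / 2 * k)"
        using mu_Phi_cube_concentration[OF int R F'] by (simp add: Q_def cube_def)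
      finally show ?thesis by simp
    qed
    have "measure Q {x \<in> cube. F x > m + k} \<le> 4 * exp (2 - deriv \<Phi> R / 2 * k)"
      using m F by (intro one_sided) (auto simp: is_median_def Q_def)
    moreover have "measure Q {x \<in> cube. - F x > - m + k} \<le> 4 * exp (2 - deriv \<Phi> R / 2 * k)"
    proof (rule one_sided)
      show "one_Lipschitz n (\<lambda>x. - F x)"
        using F by (auto simp: one_Lipschitz_def abs_minus_commute)
      show "1 / 2 \<le> measure Q {x \<in> space Q. - F x \<le> - m}"
        using m by (simp add: is_median_def Q_def)
    qed measurable
    moreover have "measure Q {x \<in> space Q. \<bar>F x - m\<bar> > k} \<le>
        measure Q {x \<in> cube. F x > m + k} + measure Q {x \<in> cube. - F x > - m + k} + \<delta>"
    proof -
      have eq: "{x \<in> cube. F x > m + k} = cube \<inter> {x \<in> space Q. F x > m + k}"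
        "{x \<in> cube. - F x > - m + k} = cube \<inter> {x \<in> space Q. - F x > - m + k}"
        using sub by auto
      have sets: "{x \<in> cube. F x > m + k} \<in> sets Q" "{x \<in> cube. - F x > - m + k} \<in> sets Q"
        "space Q - cube \<in> sets Q"
        unfolding eq by (simp_all add: Q_def)
      have "measure Q {x \<in> space Q. \<bar>F x - m\<bar> > k} \<le>
          measure Q ({x \<in> cube. F x > m + k} \<union> {x \<in> cube. - F x > - m + k} \<union> (space Q - cube))"
        using sets unfolding Q_def by (intro Q.finite_measure_mono) auto
      also have "\<dots> \<le> measure Q ({x \<in> cube. F x > m + k} \<union> {x \<in> cube. - F x > - m + k}) + \<delta>"
        using sets unfolding Q_def \<delta>_def by (intro measure_Un_le) auto
      also have "measure Q ({x \<in> cube. F x > m + k} \<union> {x \<in> cube. - F x > - m + k}) \<le>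
          measure Q {x \<in> cube. F x > m + k} + measure Q {x \<in> cube. - F x > - m + k}"
        using sets unfolding Q_def by (intro measure_Un_le) auto
      finally show ?thesis by simp
    qed
    moreover have "0 \<le> \<delta>" by (simp add: \<delta>_def)
    ultimately show ?thesis by linarith
  qed
  then show ?thesis
    using \<delta>_le by (simp add: Q_def)
qed

end

subsection \<open>Growth of the potential and removal of constants\<close>

lemma integrable_inverse_square:
  fixes a :: real
  assumes "0 < a"
  shows "integrable lborel (\<lambda>x. 1 / x\<^sup>2 * indicator {a..} x)"
proof (rule integrableI_nonneg)
  have "(\<integral>\<^sup>+x. ennreal (1 / x\<^sup>2) * indicator {a..} x \<partial>lborel) = ennreal (0 - (- 1 / a))"
  proof (rule nn_integral_FTC_atLeast)
    show "((\<lambda>x. - 1 / x) has_real_derivative 1 / x\<^sup>2) (at x)" if "a \<le> x" for x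
      using that assms by (auto intro!: derivative_eq_intros simp: power2_eq_square)
    show "((\<lambda>x. - 1 / x) \<longlongrightarrow> 0) (at_top :: real filter)"
      by real_asymp
  qed auto
  also have "(\<integral>\<^sup>+x. ennreal (1 / x\<^sup>2) * indicator {a..} x \<partial>lborel) =
      (\<integral>\<^sup>+x. ennreal (1 / x\<^sup>2 * indicator {a..} x) \<partial>lborel)"
    by (intro nn_integral_cong) (auto simp: indicator_def)
  finally show "(\<integral>\<^sup>+x. ennreal (1 / x\<^sup>2 * indicator {a..} x) \<partial>lborel) < \<infinity>"
    by simp
qed auto

text \<open>Interpolation with the trivial bound: since \<open>P \<le> 1\<close>, \<open>P\<close>
  is at most its power with exponent \<open>\<theta>\<close> in (0, 1], and
  \<open>\<theta> = ln 6 / ln C\<close> is the exponent that turns \<open>C\<close> into 6. The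
  prefactor is improved at the expense of the rate.\<close>

lemma le_6_exp_of_le_mult_exp:
  fixes C :: real
  assumes "6 < C"
  obtains \<theta> where "0 < \<theta>"
    "\<And>P q. 0 \<le> P \<Longrightarrow> P \<le> 1 \<Longrightarrow> P \<le> C * exp (- q) \<Longrightarrow> P \<le> 6 * exp (- (\<theta> * q))"
proof
  define \<theta> where "\<theta> = ln 6 / ln C"
  have \<theta>: "0 < \<theta>" "\<theta> \<le> 1"
    using assms by (auto simp: \<theta>_def)
  then show "0 < \<theta>" by simp
  show "P \<le> 6 * exp (- (\<theta> * q))" if P: "0 \<le> P" "P \<le> 1" "P \<le> C * exp (- q)" for P q
  proof (cases "P = 0")
    case False
    then have "0 < P" using P by simp
    have "ln P \<le> \<theta> * ln P"
      using \<theta> P \<open>0 < P\<close> mult_right_mono_neg[of \<theta> 1 "ln P"] by simp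
    also have "\<dots> \<le> \<theta> * ln (C * exp (- q))"
      using \<theta> P \<open>0 < P\<close> by (intro mult_left_mono ln_mono) auto
    also have "\<dots> = ln 6 - \<theta> * q"
      using assms by (simp add: ln_mult algebra_simps) (simp add: \<theta>_def)
    finally have "exp (ln P) \<le> exp (ln 6 - \<theta> * q)"
      by simp
    then show ?thesis
      using \<open>0 < P\<close> by (simp add: exp_diff exp_minus field_simps)
  qed simp
qed

text \<open>The threshold \<open>x0\<close> stands for all occurrences of "for large x" at
  once.\<close>

locale regular_concave_potential = concave_potential +
  fixes x0 B :: real
  assumes x0: "0 < x0" and B: "1 < B"
    and diff: "\<And>x. x0 \<le> x \<Longrightarrow> \<Phi> differentiable at x"
    and growth: "\<And>x. x0 \<le> x \<Longrightarrow> B * \<Phi> x \<le> \<Phi> (2 * x)"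
begin

text \<open>The tangent at \<open>x\<close> evaluated at \<open>2 * x\<close>, combined with
  doubling. Together with \<open>deriv_mult_le\<close> it makes \<open>deriv \<Phi> x\<close>
  comparable to \<open>\<Phi> x / x\<close>.\<close>

lemma deriv_mult_ge:
  assumes "x0 \<le> x"
  shows "(B - 1) * \<Phi> x \<le> x * deriv \<Phi> x"
  using below_tangent[of x "2 * x"] diff[OF assms] growth[OF assms] assms x0
  by (simp add: algebra_simps)

lemma deriv_pos:
  assumes "x0 \<le> x"
  shows "0 < deriv \<Phi> x"
proof -
  have "0 < (B - 1) * \<Phi> x"
    using B Phi_pos[of x] assms x0 by simp
  also have "\<dots> \<le> x * deriv \<Phi> x"
    by (rule deriv_mult_ge[OF assms])
  finally show ?thesis
    using assms x0 by (simp add: zero_less_mult_iff)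
qed

lemma Phi_unbounded: "\<exists>x\<ge>x0. y \<le> \<Phi> x"
proof -
  have "B ^ j * \<Phi> x0 \<le> \<Phi> (2 ^ j * x0)" for j
  proof (induction j)
    case (Suc j)
    have "x0 \<le> 2 ^ j * x0"
      using x0 by simp
    from growth[OF this] have "B * \<Phi> (2 ^ j * x0) \<le> \<Phi> (2 ^ Suc j * x0)"
      by (simp add: mult.assoc)
    moreover have "B * (B ^ j * \<Phi> x0) \<le> B * \<Phi> (2 ^ j * x0)"
      using Suc B by (intro mult_left_mono) auto
    ultimately show ?case
      by (simp add: mult.assoc)
  qed simp
  moreover obtain j where "y / \<Phi> x0 < B ^ j"
    using real_arch_pow[OF B] by blast
  then have "y \<le> B ^ j * \<Phi> x0"
    using Phi_pos[OF x0] by (simp add: field_simps)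
  ultimately have "y \<le> \<Phi> (2 ^ j * x0)"
    by (rule order_trans[rotated])
  moreover have "x0 \<le> 2 ^ j * x0"
    using x0 by simp
  ultimately show ?thesis by blast
qed

text \<open>Iterated doubling makes \<open>\<Phi>\<close> unbounded, so eventually
  \<open>8 \<le> (B - 1) * \<Phi> t \<le> t * deriv \<Phi> t\<close>, and
  \<open>\<Phi> - 8 * ln\<close> is nondecreasing from there on. The coefficient 8 bounds
  \<open>exp (- \<Phi> x / 4)\<close> by a multiple of the integrable
  \<open>1 / x\<^sup>2\<close>.\<close>

lemma Phi_ge_log:
  obtains x1 c where "1 \<le> x1" "\<And>x. x1 \<le> x \<Longrightarrow> 8 * ln x + c \<le> \<Phi> x"
proof -
  obtain z where z: "x0 \<le> z" "8 / (B - 1) \<le> \<Phi> z"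
    using Phi_unbounded by blast
  define x1 where "x1 = max 1 z"
  have "\<Phi> x1 - 8 * ln x1 \<le> \<Phi> x - 8 * ln x" if "x1 \<le> x" for x
  proof (rule DERIV_nonneg_imp_nondecreasing[OF that])
    fix t assume "x1 \<le> t" "t \<le> x"
    then have t: "1 \<le> t" "x0 \<le> t" "z \<le> t"
      using z by (auto simp: x1_def)
    have "8 / (B - 1) \<le> \<Phi> t"
      using z Phi_le[of z t] t x0 by simp
    then have "8 \<le> (B - 1) * \<Phi> t"
      using B by (simp add: field_simps)
    also have "\<dots> \<le> t * deriv \<Phi> t"
      by (rule deriv_mult_ge[OF t(2)])
    finally have "0 \<le> deriv \<Phi> t - 8 * (1 / t)"
      using t by (simp add: field_simps)
    moreover have "(\<Phi> has_real_derivative deriv \<Phi> t) (at t)"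
      using diff[OF t(2)] by (simp add: DERIV_deriv_iff_real_differentiable)
    then have "((\<lambda>x. \<Phi> x - 8 * ln x) has_real_derivative deriv \<Phi> t - 8 * (1 / t)) (at t)"
      using t by (auto intro!: derivative_eq_intros)
    ultimately show "\<exists>d. ((\<lambda>x. \<Phi> x - 8 * ln x) has_real_derivative d) (at t) \<and> 0 \<le> d"
      by blast
  qed
  then have "8 * ln x + (\<Phi> x1 - 8 * ln x1) \<le> \<Phi> x" if "x1 \<le> x" for x
    using that by (simp add: algebra_simps)
  moreover have "1 \<le> x1" by (simp add: x1_def)
  ultimately show ?thesis using that by blast
qed

lemma integrable_exp_Phi_4: "integrable lborel (\<lambda>x. exp (- \<Phi> \<bar>x\<bar> / 4))"
proof -
  obtain x1 c where x1: "1 \<le> x1" and le: "\<And>x. x1 \<le> x \<Longrightarrow> 8 * ln x + c \<le> \<Phi> x"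
    by (rule Phi_ge_log) blast
  define h where "h = (\<lambda>x::real. 1 / x\<^sup>2 * indicator {x1..} x)"
  have h: "integrable lborel h"
    unfolding h_def using x1 by (intro integrable_inverse_square) auto
  have h': "integrable lborel (\<lambda>x. h (- x))"
    using lborel_integrable_real_affine[OF h, of "-1" 0] by simp
  have "integrable lborel (\<lambda>x. indicator {-x1..x1} x + exp (- c / 4) * (h x + h (- x)))"
    using h h' by (intro Bochner_Integration.integrable_add integrable_mult_right integrable_real_indicator)
      (auto simp: emeasure_lborel_Icc_eq)
  then show ?thesis
  proof (rule Bochner_Integration.integrable_bound)
    show "(\<lambda>x. exp (- \<Phi> \<bar>x\<bar> / 4)) \<in> borel_measurable lborel"
      by measurable
    have h0: "0 \<le> h x" for x by (simp add: h_def)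
    have "exp (- \<Phi> \<bar>x\<bar> / 4) \<le> indicator {-x1..x1} x + exp (- c / 4) * (h x + h (- x))" for x
    proof (cases "\<bar>x\<bar> \<le> x1")
      case True
      have "exp (- \<Phi> \<bar>x\<bar> / 4) \<le> 1"
        by (simp add: Phi_nonneg)
      moreover have "0 \<le> exp (- c / 4) * (h x + h (- x))"
        using h0[of x] h0[of "-x"] by simp
      moreover have "x \<in> {-x1..x1}"
        using True by auto
      ultimately show ?thesis
        by (simp only: indicator_simps)
    next
      case False
      then have pos: "0 < \<bar>x\<bar>" "x1 \<le> \<bar>x\<bar>" using x1 by auto
      have "exp (- \<Phi> \<bar>x\<bar> / 4) \<le> exp (- c / 4 - 2 * ln \<bar>x\<bar>)"
        using le[OF pos(2)] by simp
      also have "\<dots> = exp (- c / 4) * (1 / x\<^sup>2)"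
        using pos by (simp add: exp_diff exp_double)
      also have "1 / x\<^sup>2 \<le> h x + h (- x)"
        using pos h0[of x] h0[of "-x"] by (cases "0 \<le> x") (simp_all add: h_def)
      finally have "exp (- \<Phi> \<bar>x\<bar> / 4) \<le> exp (- c / 4) * (h x + h (- x))"
        by simp
      then show ?thesis
        by (simp add: add_increasing)
    qed
    then show "AE x in lborel. norm (exp (- \<Phi> \<bar>x\<bar> / 4)) \<le>
        norm (indicator {-x1..x1} x + exp (- c / 4) * (h x + h (- x)))"
      by (auto intro!: AE_I2 order_trans[OF _ abs_ge_self])
  qed
qed

lemma integrable_exp_Phi: "integrable lborel (\<lambda>x. exp (- \<Phi> \<bar>x\<bar>))"
  by (rule Bochner_Integration.integrable_bound[OF integrable_exp_Phi_4]) (auto simp: Phi_nonneg)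

text \<open>A value above \<open>\<Phi> k\<close> lies in the range, by unboundedness and the
  intermediate value theorem on an interval away from 0, where \<open>\<Phi>\<close> is continuous;
  so \<open>inv_into\<close> returns a genuine preimage.\<close>

lemma inv_Phi:
  assumes k: "x0 \<le> k" and y: "\<Phi> k \<le> y"
  defines "R \<equiv> inv_into {0..} \<Phi> y"
  shows "k \<le> R" "\<Phi> R = y"
proof -
  obtain z where z: "x0 \<le> z" "y \<le> \<Phi> z"
    using Phi_unbounded by blast
  have "k \<le> z"
  proof (rule ccontr)
    assume "\<not> k \<le> z"
    then show False
      using Phi_less[of z k] z y x0 by simp
  qed
  have "\<exists>x\<ge>k. x \<le> z \<and> \<Phi> x = y"
    using y z \<open>k \<le> z\<close> k x0
    by (intro IVT' continuous_on_subset[OF continuous_on_Phi]) auto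
  then have "y \<in> \<Phi> ` {0..}"
    using k x0 by force
  then have R: "0 \<le> R" "\<Phi> R = y"
    unfolding R_def using inv_into_into[of y \<Phi> "{0..}"] f_inv_into_f[of y \<Phi> "{0..}"] by auto
  then show "\<Phi> R = y" by simp
  show "k \<le> R"
  proof (rule ccontr)
    assume "\<not> k \<le> R"
    then show False
      using Phi_less[of R k] R y by simp
  qed
qed

lemma concentration:
  obtains c where "0 < c"
    "\<And>n F m k. n \<ge> 1 \<Longrightarrow> one_Lipschitz n F \<Longrightarrow> is_median (mu_Phi_n \<Phi> n) F m \<Longrightarrow> x0 \<le> k \<Longrightarrow>
      measure (mu_Phi_n \<Phi> n) {x \<in> space (mu_Phi_n \<Phi> n). \<bar>F x - m\<bar> > k}
      \<le> 6 * exp (- (c * k * deriv \<Phi> (inv_into {0..} \<Phi> (max (\<Phi> k) (2 * ln (real n))))))"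
proof -
  define C where "C = (LINT x|lborel. exp (- \<Phi> \<bar>x\<bar> / 4)) / Z_Phi \<Phi>"
  have C: "0 \<le> C"
    unfolding C_def using Z_Phi_pos[OF integrable_exp_Phi] by (intro divide_nonneg_pos integral_nonneg_AE) auto
  define C2 where "C2 = 4 * C + 8 * exp 2"
  have "6 < C2"
    using C exp_ge_add_one_self[of 2] unfolding C2_def by linarith
  then obtain \<theta> where \<theta>: "0 < \<theta>"
    "\<And>P q. 0 \<le> P \<Longrightarrow> P \<le> 1 \<Longrightarrow> P \<le> C2 * exp (- q) \<Longrightarrow> P \<le> 6 * exp (- (\<theta> * q))"
    by (rule le_6_exp_of_le_mult_exp) blast
  have bound: "measure (mu_Phi_n \<Phi> n) {x \<in> space (mu_Phi_n \<Phi> n). \<bar>F x - m\<bar> > k}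
      \<le> 6 * exp (- (\<theta> / 4 * k * deriv \<Phi> (inv_into {0..} \<Phi> (max (\<Phi> k) (2 * ln (real n))))))"
    (is "?P \<le> _")
    if n: "n \<ge> 1" and F: "one_Lipschitz n F" and m: "is_median (mu_Phi_n \<Phi> n) F m" and k: "x0 \<le> k"
    for n F m k
  proof -
    define R where "R = inv_into {0..} \<Phi> (max (\<Phi> k) (2 * ln (real n)))"
    define D where "D = deriv \<Phi> R"
    have R: "k \<le> R" "\<Phi> R = max (\<Phi> k) (2 * ln (real n))"
      unfolding R_def using inv_Phi[OF k, of "max (\<Phi> k) (2 * ln (real n))"] by simp_all
    have R0: "0 < R" "x0 \<le> R" using R k x0 by auto
    have D: "0 < D" unfolding D_def by (rule deriv_pos[OF R0(2)])
    interpret Q: prob_space "mu_Phi_n \<Phi> n"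
      unfolding mu_Phi_n_def by (intro prob_space_PiM prob_space_mu_Phi integrable_exp_Phi)
    \<comment> \<open>This makes the tail term, which decays in \<open>\<Phi> R\<close>, comparable
      to the deviation term, which decays in \<open>k * D\<close>.\<close>
    have kD: "k * D \<le> \<Phi> R"
    proof -
      have "k * D \<le> R * D"
        using R D by (intro mult_right_mono) auto
      also have "\<dots> \<le> \<Phi> R"
        unfolding D_def by (rule deriv_mult_le[OF R0(1) diff[OF R0(2)]])
      finally show ?thesis .
    qed
    have "?P \<le> 4 * real n * C * exp (- (3 / 4) * \<Phi> R) + 8 * exp (2 - D / 2 * k)"
      unfolding C_def D_def
      by (rule median_concentration[OF integrable_exp_Phi integrable_exp_Phi_4 R0(1) diff[OF R0(2)]
            deriv_pos[OF R0(2)] F m])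
    also have "\<dots> \<le> 4 * C * exp (- (k * D / 4)) + 8 * exp 2 * exp (- (k * D / 4))"
    proof (rule add_mono)
      \<comment> \<open>The entry \<open>2 * ln (real n)\<close> of the maximum enters here: the
        dimension is at most \<open>exp (\<Phi> R / 2)\<close>.\<close>
      have "real n = exp (ln (real n))"
        using n by simp
      also have "\<dots> \<le> exp (\<Phi> R / 2)"
        using R(2) by simp
      finally have "real n * exp (- (3 / 4) * \<Phi> R) \<le> exp (\<Phi> R / 2) * exp (- (3 / 4) * \<Phi> R)"
        by (intro mult_right_mono) auto
      also have "\<dots> = exp (- \<Phi> R / 4)"
        by (simp flip: exp_add)
      also have "\<dots> \<le> exp (- (k * D / 4))"
        using kD by simp
      finally have "4 * C * (real n * exp (- (3 / 4) * \<Phi> R)) \<le> 4 * C * exp (- (k * D / 4))"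
        using C by (intro mult_left_mono) auto
      then show "4 * real n * C * exp (- (3 / 4) * \<Phi> R) \<le> 4 * C * exp (- (k * D / 4))"
        by (simp add: mult_ac)
      have "0 \<le> k * D"
        using k x0 D by simp
      then have "exp (2 - D / 2 * k) \<le> exp (2 + - (k * D / 4))"
        by (simp add: mult.commute)
      then show "8 * exp (2 - D / 2 * k) \<le> 8 * exp 2 * exp (- (k * D / 4))"
        by (simp only: exp_add)
    qed
    also have "\<dots> = C2 * exp (- (k * D / 4))"
      by (simp add: C2_def algebra_simps)
    finally have "?P \<le> 6 * exp (- (\<theta> * (k * D / 4)))"
      by (intro \<theta>(2)) auto
    then show ?thesis
      by (simp add: D_def R_def mult.assoc)
  qed
  show ?thesis
    by (rule that[OF _ bound]) (use \<theta>(1) in auto)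
qed

end

section \<open>Constants independent of the dimension, and the comparison of the two bounds\<close>

theorem proposition10:
  fixes \<Phi> :: "real \<Rightarrow> real"
  assumes Phi_nonneg: "\<And>x. x \<ge> 0 \<Longrightarrow> \<Phi> x \<ge> 0"
    and Phi_mono: "strict_mono_on {0..} \<Phi>"
    and Phi_concave: "concave_on {0..} \<Phi>"
    and Phi_zero: "\<Phi> 0 = 0"
    and Phi_C2: "C2_near_top \<Phi>"
    and Phi_growth: "\<exists>B>1. \<forall>\<^sub>F x in at_top. \<Phi> (2 * x) \<ge> B * \<Phi> x"
    and Phi_second: "\<exists>C>0. \<forall>\<^sub>F x in at_top. \<bar>x * deriv (deriv \<Phi>) x\<bar> \<le> C * deriv \<Phi> x"
  shows "\<exists>c>0. \<exists>c'>0. \<exists>K>0. \<forall>n\<ge>1. \<forall>F m. \<forall>k::nat.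
           one_Lipschitz n F \<longrightarrow> is_median (mu_Phi_n \<Phi> n) F m \<longrightarrow> real k \<ge> K \<longrightarrow>
             measure (mu_Phi_n \<Phi> n) {x \<in> space (mu_Phi_n \<Phi> n). \<bar>F x - m\<bar> > real k}
               \<le> 6 * exp_neg (ereal (c * real k) *
                      right_deriv \<Phi> (inv_into {0..} \<Phi> (max (\<Phi> (real k)) (2 * ln (real n)))))
           \<and> 6 * exp_neg (ereal (c * real k) *
                      right_deriv \<Phi> (inv_into {0..} \<Phi> (max (\<Phi> (real k)) (2 * ln (real n)))))
               \<le> 6 * max (exp (- c' * \<Phi> (real k)))
                         (exp_neg (ereal (c * real k) *
                            right_deriv \<Phi> (inv_into {0..} \<Phi> (2 * ln (real n)))))"
proof -
  interpret concave_potential \<Phi>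
    by standard fact+
  obtain a where a: "\<forall>x>a. \<Phi> differentiable (at x)"
    using Phi_C2 by (auto simp: C2_near_top_def)
  obtain B where B: "1 < B" and ev: "\<forall>\<^sub>F x in at_top. \<Phi> (2 * x) \<ge> B * \<Phi> x"
    using Phi_growth by blast
  then obtain b where b: "\<forall>x\<ge>b. \<Phi> (2 * x) \<ge> B * \<Phi> x"
    by (auto simp: eventually_at_top_linorder)
  \<comment> \<open>The entry 1 ensures positivity, and \<open>a + 1\<close> turns the strict
    threshold \<open>a\<close> into a non-strict one.\<close>
  define x0 where "x0 = max 1 (max (a + 1) b)"
  interpret regular_concave_potential \<Phi> x0 B
    by standard (use a b B in \<open>auto simp: x0_def\<close>)
  obtain c where c: "0 < c" and conc:
    "\<And>n F m k. n \<ge> 1 \<Longrightarrow> one_Lipschitz n F \<Longrightarrow> is_median (mu_Phi_n \<Phi> n) F m \<Longrightarrow> x0 \<le> k \<Longrightarrow>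
      measure (mu_Phi_n \<Phi> n) {x \<in> space (mu_Phi_n \<Phi> n). \<bar>F x - m\<bar> > k}
      \<le> 6 * exp (- (c * k * deriv \<Phi> (inv_into {0..} \<Phi> (max (\<Phi> k) (2 * ln (real n))))))"
    by (rule concentration) blast
  \<comment> \<open>The preimage is at least \<open>x0\<close>, where \<open>\<Phi>\<close> is
    differentiable, so the extended right derivative is finite and equals the ordinary one.\<close>
  have exp_neg_eq: "exp_neg (ereal (c * k) * right_deriv \<Phi> (inv_into {0..} \<Phi> (max (\<Phi> k) y))) =
      exp (- (c * k * deriv \<Phi> (inv_into {0..} \<Phi> (max (\<Phi> k) y))))"
    if k: "x0 \<le> k" for k y
  proof -
    have "x0 \<le> inv_into {0..} \<Phi> (max (\<Phi> k) y)"
      using inv_Phi(1)[OF k, of "max (\<Phi> k) y"] k by simp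
    from diff[OF this]
    have "right_deriv \<Phi> (inv_into {0..} \<Phi> (max (\<Phi> k) y)) =
        ereal (deriv \<Phi> (inv_into {0..} \<Phi> (max (\<Phi> k) y)))"
      by (intro right_deriv_eq_deriv) (simp add: DERIV_deriv_iff_real_differentiable)
    then show ?thesis
      by (simp add: exp_neg_def)
  qed
  \<comment> \<open>If \<open>\<Phi> k \<le> y\<close>, the left side is the second entry of the
    maximum. Otherwise the preimage is \<open>k\<close> itself and \<open>deriv_mult_ge\<close>
    yields the first entry, whence the second constant \<open>c * (B - 1)\<close>. The latter case
    contains \<open>n = 1\<close>, where the right derivative at 0 may be infinite but need not be
    evaluated.\<close>
  have second: "exp_neg (ereal (c * k) * right_deriv \<Phi> (inv_into {0..} \<Phi> (max (\<Phi> k) y))) \<le>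
      max (exp (- (c * (B - 1)) * \<Phi> k)) (exp_neg (ereal (c * k) * right_deriv \<Phi> (inv_into {0..} \<Phi> y)))"
    if k: "x0 \<le> k" for k y
  proof (cases "\<Phi> k \<le> y")
    case False
    have "inv_into {0..} \<Phi> (\<Phi> k) = k"
      using Phi_mono k x0 by (intro inv_into_f_f strict_mono_on_imp_inj_on) auto
    then have "exp_neg (ereal (c * k) * right_deriv \<Phi> (inv_into {0..} \<Phi> (max (\<Phi> k) y))) =
        exp (- (c * (k * deriv \<Phi> k)))"
      using exp_neg_eq[OF k, of y] False by (simp add: max_def mult.assoc)
    also have "\<dots> \<le> exp (- (c * (B - 1)) * \<Phi> k)"
      using mult_left_mono[OF deriv_mult_ge[OF k], of c] c by (simp add: mult.assoc)
    finally show ?thesis by simp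
  qed (simp add: max_def)
  have c': "0 < c * (B - 1)"
    using c B by simp
  show ?thesis
  proof (rule exI[of _ c], rule conjI[OF c], rule exI[of _ "c * (B - 1)"], rule conjI[OF c'],
      rule exI[of _ x0], rule conjI[OF x0], intro allI impI conjI)
    fix n F m and k :: nat
    assume n: "1 \<le> n" and F: "one_Lipschitz n F" and m: "is_median (mu_Phi_n \<Phi> n) F m"
      and k: "x0 \<le> real k"
    show "measure (mu_Phi_n \<Phi> n) {x \<in> space (mu_Phi_n \<Phi> n). \<bar>F x - m\<bar> > real k}
        \<le> 6 * exp_neg (ereal (c * real k) *
          right_deriv \<Phi> (inv_into {0..} \<Phi> (max (\<Phi> (real k)) (2 * ln (real n)))))"
      using conc[OF n F m k] by (simp add: exp_neg_eq[OF k])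
    show "6 * exp_neg (ereal (c * real k) *
          right_deriv \<Phi> (inv_into {0..} \<Phi> (max (\<Phi> (real k)) (2 * ln (real n)))))
        \<le> 6 * max (exp (- (c * (B - 1)) * \<Phi> (real k)))
          (exp_neg (ereal (c * real k) * right_deriv \<Phi> (inv_into {0..} \<Phi> (2 * ln (real n)))))"
      using second[OF k, of "2 * ln (real n)"] by (intro mult_left_mono) auto
  qed
qed

end
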